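(* Let $\delta\in\mathbb{N}$. There exists $D_{\delta,n}\in\mathbb{N}$ such that for any equigenerated defect $\delta$ ideal $I\subseteq R$ with $\alpha(I)\ge D_{\delta,n}$, there exists a lex plus powers ideal $J=L+(x_1^{\alpha(I)},\dots,x_n^{\alpha(I)})$, with $L$ a lex ideal, that has the same Hilbert function as $I$ in degrees $\le\alpha(I)+1$, i.e. $\dim_K J_d=\dim_K I_d$ for all $d\le\alpha(I)+1$.
   Context: $\mathbb{N}=\{0,1,2,\dots\}$. $K$ is a field of characteristic $0$, $n\ge 3$, $R=K[x_1,\dots,x_n]$ is standard graded, and all ideals are homogeneous. $\alpha(I)$ is the smallest degree of a minimal generator of $I$. An ideal is equigenerated if all its minimal generators have the same degree. A defect $\delta$ ideal is an ideal that is minimally generated by $n+\delta$ forms and contains a regular sequence of length $n$. Lexicographic order: for monomials of the same degree, $x_1^{p_1}\cdots x_n^{p_n}>x_1^{q_1}\cdots x_n^{q_n}$ if the first nonzero entry of $(p_1-q_1,\dots,p_n-q_n)$ is positive. A lex ideal is a monomial ideal that, whenever it contains a monomial, contains every lex-larger monomial of the same degree. A lex plus powers (LPP) ideal is an ideal $L+P$ with $L$ a lex ideal and $P=(x_1^{e_1},\dots,x_\ell^{e_\ell})$, $e_1\le\cdots\le e_\ell$, $\ell\leq n$. *)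

theory Defs
  imports
    Complex_Main
    "HOL-Library.Poly_Mapping"
    "HOL-Library.Set_Algebras"
    "HOL-Library.Numeral_Type"
begin

section \<open>The polynomial ring\<close>

text \<open>
  The variables are indexed by a finite linearly ordered type \<open>'n\<close>, so that the number of
  variables is \<open>CARD('n)\<close>; the least index corresponds to the first variable. A monomial is
  identified with its exponent vector, and a polynomial with its finitely supported coefficient
  function.
\<close>

type_synonym 'n monomial = "'n \<Rightarrow>\<^sub>0 nat"
type_synonym ('n, 'k) mpoly = "'n monomial \<Rightarrow>\<^sub>0 'k"

definition monom :: "'n monomial \<Rightarrow> ('n, 'k::zero_neq_one) mpoly" where
  "monom u = Poly_Mapping.single u 1"

definition var :: "'n \<Rightarrow> ('n, 'k::zero_neq_one) mpoly" where
  "var i = monom (Poly_Mapping.single i 1)"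

definition scale :: "'k \<Rightarrow> ('n, 'k) mpoly \<Rightarrow> ('n, 'k::comm_semiring_1) mpoly" where
  "scale c p = Poly_Mapping.single 0 c * p"

global_interpretation mpoly: vector_space "scale :: 'k::field \<Rightarrow> ('n, 'k) mpoly \<Rightarrow> ('n, 'k) mpoly"
  defines dim = mpoly.dim
  by unfold_locales
    (auto simp: scale_def algebra_simps single_add mult_single simp flip: mult.assoc)

text \<open>Ideals of a commutative ring are its submodules over itself:
  \<open>ideal B\<close> is the ideal generated by \<open>B\<close>.\<close>

global_interpretation ring_module: module "(*) :: 'a::comm_ring_1 \<Rightarrow> 'a \<Rightarrow> 'a"
  defines ideal = ring_module.span
  by unfold_locales (auto simp: algebra_simps)

section \<open>Grading and Hilbert function\<close>

definition mdeg :: "'n::finite monomial \<Rightarrow> nat" where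
  "mdeg u = (\<Sum>i\<in>UNIV. Poly_Mapping.lookup u i)"

text \<open>The zero polynomial counts as a form of every degree.\<close>

definition is_form :: "nat \<Rightarrow> ('n::finite, 'k::zero) mpoly \<Rightarrow> bool" where
  "is_form d p \<longleftrightarrow> (\<forall>u\<in>Poly_Mapping.keys p. mdeg u = d)"

definition graded_part :: "('n::finite, 'k::zero) mpoly set \<Rightarrow> nat \<Rightarrow> ('n, 'k) mpoly set" where
  "graded_part I d = {p \<in> I. is_form d p}"

definition hilbert_function :: "('n::finite, 'k::field) mpoly set \<Rightarrow> nat \<Rightarrow> nat" where
  "hilbert_function I d = dim (graded_part I d)"

section \<open>Defect ideals\<close>

definition minimally_generates :: "('n::finite, 'k::comm_ring_1) mpoly set \<Rightarrow> ('n, 'k) mpoly set \<Rightarrow> bool" where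
  "minimally_generates G I \<longleftrightarrow>
     (\<forall>g\<in>G. \<exists>d. is_form d g) \<and> ideal G = I \<and> (\<forall>G'. G' \<subset> G \<longrightarrow> ideal G' \<noteq> I)"

definition minimal_generator :: "('n::finite, 'k::comm_ring_1) mpoly \<Rightarrow> ('n, 'k) mpoly set \<Rightarrow> bool" where
  "minimal_generator g I \<longleftrightarrow> (\<exists>G. minimally_generates G I \<and> g \<in> G)"

definition alpha :: "('n::finite, 'k::comm_ring_1) mpoly set \<Rightarrow> nat" where
  "alpha I = (LEAST d. \<exists>g. minimal_generator g I \<and> is_form d g)"

definition equigenerated :: "('n::finite, 'k::comm_ring_1) mpoly set \<Rightarrow> bool" where
  "equigenerated I \<longleftrightarrow> (\<exists>d. \<forall>g. minimal_generator g I \<longrightarrow> is_form d g)"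

definition regular_sequence :: "'a::comm_ring_1 list \<Rightarrow> bool" where
  "regular_sequence fs \<longleftrightarrow>
     ideal (set fs) \<noteq> UNIV \<and>
     (\<forall>i<length fs. \<forall>g. fs ! i * g \<in> ideal (set (take i fs)) \<longrightarrow> g \<in> ideal (set (take i fs)))"

definition defect_ideal :: "nat \<Rightarrow> ('n::finite, 'k::comm_ring_1) mpoly set \<Rightarrow> bool" where
  "defect_ideal \<delta> I \<longleftrightarrow>
     (\<exists>G. minimally_generates G I \<and> finite G \<and> card G = CARD('n) + \<delta>) \<and>
     (\<exists>fs. set fs \<subseteq> I \<and> length fs = CARD('n) \<and> regular_sequence fs)"

section \<open>Lex plus powers ideals\<close>

definition monomial_ideal :: "('n, 'k::comm_ring_1) mpoly set \<Rightarrow> bool" where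
  "monomial_ideal I \<longleftrightarrow> (\<exists>M. I = ideal (monom ` M))"

definition lex_less :: "'n::linorder monomial \<Rightarrow> 'n monomial \<Rightarrow> bool" where
  "lex_less v u \<longleftrightarrow>
     (\<exists>i. (\<forall>j<i. Poly_Mapping.lookup u j = Poly_Mapping.lookup v j) \<and>
          Poly_Mapping.lookup v i < Poly_Mapping.lookup u i)"

definition lex_ideal :: "('n::{finite,linorder}, 'k::comm_ring_1) mpoly set \<Rightarrow> bool" where
  "lex_ideal L \<longleftrightarrow> monomial_ideal L \<and>
     (\<forall>u v. monom v \<in> L \<longrightarrow> mdeg u = mdeg v \<longrightarrow> lex_less v u \<longrightarrow> monom u \<in> L)"

text \<open>The set \<open>S\<close> plays the role of the initial segment \<open>{1..l}\<close> of the indices, where \<open>l \<le> n\<close>.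
  The sum of ideals is the elementwise sum of sets.\<close>

definition lpp_ideal :: "('n::{finite,linorder}, 'k::comm_ring_1) mpoly set \<Rightarrow> bool" where
  "lpp_ideal J \<longleftrightarrow>
     (\<exists>L S e. lex_ideal L \<and> (\<forall>i\<in>S. \<forall>j\<le>i. j \<in> S) \<and> mono_on S e \<and>
              J = L + ideal ((\<lambda>i. var i ^ e i) ` S))"

end

theory Submission
  imports Defs "HOL-Library.FuncSet"
begin

text \<open>
  Write \<open>R\<^sub>d\<close> for the forms of degree \<open>d\<close>, \<open>n\<close> for the number of variables, and let \<open>I\<close> be minimally
  generated by a set \<open>G\<close> of \<open>n + \<delta>\<close> forms of degree \<open>a\<close>. Below degree \<open>a\<close> there is nothing to do. In
  degree \<open>a\<close> the lex plus powers ideal has to consist of the \<open>n\<close> pure powers and the lex segment \<open>L\<close> of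
  \<open>\<delta> + 1\<close> monomials, which for \<open>a > \<delta>\<close> contains just one pure power. In degree \<open>a + 1\<close> the
  lex part can be enlarged one monomial at a time (\<open>lpp_ideal_exists\<close>). So everything
  comes down to the inequality
  \<open>dim I\<^sub>a\<^sub>+\<^sub>1 \<ge> n * (n - 1) + card (grow UNIV L)\<close> (\<open>hilbert_function_next_ge\<close>),
  where \<open>grow UNIV L\<close> is the set of products of a variable and a member of \<open>L\<close>. It says that the
  members of \<open>G\<close> do not have too many linear syzygies.

  Consider the linear syzygies of \<open>G\<close> as a matrix of linear forms, whose size and degrees have
  nothing to do with \<open>a\<close>. Elimination (\<open>elimination\<close>) gives a subset \<open>J\<close> of \<open>G\<close> and a form
  \<open>\<Delta> \<noteq> 0\<close> of degree \<open>D < 2 ^ card G\<close> such that modulo the syzygies \<open>\<Delta> * g\<close> is an \<open>R\<close>-combination, with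
  coefficients \<open>p g j\<close> of degree \<open>D\<close>, of the members \<open>j\<close> of \<open>J\<close>, and such that the vectors \<open>p g\<close>
  satisfy all the linear syzygies of \<open>G\<close>. The number \<open>card J\<close> is the corank of the matrix.

  The essential point is that \<open>card J \<ge> n\<close> as soon as \<open>a > D\<close> (\<open>card_ge_of_low_multiple\<close>).
  A regular sequence of length \<open>n\<close> forces \<open>I\<close> to contain all forms of large degree
  (\<open>forms_in_ideal_of_regular_sequence\<close>), and then multiplication by \<open>\<Delta>\<close> maps forms of
  large degree to combinations of \<open>J\<close> whose coefficients have a degree smaller by \<open>a - D > 0\<close>.
  Iterating \<open>t\<close> times, a space of dimension of order \<open>t ^ (n - 1)\<close> is embedded into one of
  dimension of order \<open>t ^ (card J - 1)\<close>.

  Since every linear syzygy of \<open>G\<close> holds for the vectors \<open>p g \<in> R ^ J\<close>, the space \<open>I\<^sub>a\<^sub>+\<^sub>1\<close> is at least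
  as large as the one spanned by the products of variables and these vectors. In \<open>R ^ J\<close> one may pass
  to leading terms. These form nonempty sets \<open>A j\<close> of monomials, one for each coordinate \<open>j\<close>, with
  \<open>n + \<delta>\<close> elements in total. Gluing them to one set loses one element and at least \<open>n\<close> of the growth
  at each step (\<open>glue_sets\<close>), so one gets a set \<open>C\<close> with \<open>n + \<delta> + 1 - card J \<le> \<delta> + 1\<close> elements and
  \<open>dim I\<^sub>a\<^sub>+\<^sub>1 \<ge> n * (card J - 1) + card (grow UNIV C)\<close>. Its degree is bounded in terms of \<open>n + \<delta>\<close>; if
  \<open>a\<close> exceeds this bound, \<open>C\<close> can be translated to degree \<open>a\<close> and compared with a lex segment there by
  Macaulay's theorem (\<open>Macaulay_monomials\<close>).
\<close>

text \<open>For a ring as a module over itself this simplification rule is associativity read from right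
  to left; it loops together with \<open>mult.assoc\<close>.\<close>

declare ring_module.scale_scale [simp del]

section \<open>Monomials and the lexicographic order\<close>

abbreviation ex :: "'n \<Rightarrow> 'n monomial" where
  "ex i \<equiv> Poly_Mapping.single i (Suc 0)"

abbreviation ev :: "'n monomial \<Rightarrow> 'n \<Rightarrow> nat" where
  "ev \<equiv> Poly_Mapping.lookup"

abbreviation keys :: "('a \<Rightarrow>\<^sub>0 'b::zero) \<Rightarrow> 'a set" where
  "keys \<equiv> Poly_Mapping.keys"

definition mons :: "'n::finite set \<Rightarrow> nat \<Rightarrow> 'n monomial set" where
  "mons X d = {u. keys u \<subseteq> X \<and> mdeg u = d}"

lemma mons_UNIV: "mons UNIV d = {u. mdeg u = d}"
  by (simp add: mons_def)

lemma mdeg_add [simp]: "mdeg (u + v) = mdeg u + mdeg v"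
  by (simp add: mdeg_def lookup_add sum.distrib)

lemma mdeg_single [simp]: "mdeg (Poly_Mapping.single i k) = k"
  by (simp add: mdeg_def lookup_single when_def)

lemma mdeg_zero [simp]: "mdeg 0 = 0"
  by (simp add: mdeg_def)

lemma mdeg_sum: "mdeg (sum f A) = (\<Sum>a\<in>A. mdeg (f a))"
  by (induction A rule: infinite_finite_induct) auto

lemma exponent_le_mdeg: "ev u i \<le> mdeg u"
  unfolding mdeg_def by (intro member_le_sum) auto

lemma mdeg_strict_mono:
  assumes "\<And>i. ev u i \<le> ev v i" "ev u k < ev v k"
  shows "mdeg u < mdeg v"
  unfolding mdeg_def using assms by (intro sum_strict_mono_ex1) auto

lemma monomial_split_off:
  assumes "ev u i > 0"
  shows "u = ex i + (u - ex i)"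
  using assms by (intro poly_mapping_eqI) (auto simp: lookup_add lookup_minus lookup_single when_def)

lemma mdeg_diff_ex: "ev u i > 0 \<Longrightarrow> mdeg (u - ex i) = mdeg u - 1"
  using arg_cong[OF monomial_split_off, of u i mdeg] unfolding mdeg_add mdeg_single by linarith

lemma mdeg_update: "mdeg (Poly_Mapping.update k c u) + ev u k = mdeg u + c"
proof -
  have "mdeg (Poly_Mapping.update k c u) = c + (\<Sum>i\<in>UNIV - {k}. ev u i)"
    unfolding mdeg_def by (subst sum.remove[of _ k]) (auto simp: lookup_update)
  moreover have "mdeg u = ev u k + (\<Sum>i\<in>UNIV - {k}. ev u i)"
    unfolding mdeg_def by (subst sum.remove[of _ k]) auto
  ultimately show ?thesis by simp
qed

lemma finite_bounded_monomials: "finite {u :: 'n::finite monomial. \<forall>i. ev u i \<le> d}"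
proof (rule inj_on_finite)
  show "inj_on ev {u :: 'n monomial. \<forall>i. ev u i \<le> d}"
    by (rule inj_onI, rule poly_mapping_eqI) metis
  show "ev ` {u :: 'n monomial. \<forall>i. ev u i \<le> d} \<subseteq> Pi\<^sub>E UNIV (\<lambda>_. {..d})"
    by (auto simp: PiE_def)
qed (auto intro: finite_PiE)

lemma finite_mons [simp]: "finite (mons X d)"
  by (rule finite_subset[OF _ finite_bounded_monomials[of d]])
    (auto simp: mons_def exponent_le_mdeg)

lemma monomial_less_iff:
  "u < v \<longleftrightarrow> (\<exists>i. ev u i < ev v i \<and> (\<forall>j<i. ev u j = ev v j))"
  by transfer (simp add: less_fun_def)

lemma lex_less_eq_less: "lex_less v u \<longleftrightarrow> v < u"
  unfolding lex_less_def monomial_less_iff by (metis (no_types, lifting))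

text \<open>The monomials of degree \<open>d + 1\<close> in the ideal generated by a set \<open>A\<close> of monomials of degree \<open>d\<close>
  in the variables \<open>X\<close>, also known as the upper shadow of \<open>A\<close>.\<close>

definition grow :: "'n set \<Rightarrow> 'n monomial set \<Rightarrow> 'n monomial set" where
  "grow X A = (\<Union>i\<in>X. (+) (ex i) ` A)"

lemma grow_iff: "w \<in> grow X A \<longleftrightarrow> (\<exists>i\<in>X. \<exists>u\<in>A. w = ex i + u)"
  by (auto simp: grow_def)

lemma growI: "i \<in> X \<Longrightarrow> u \<in> A \<Longrightarrow> ex i + u \<in> grow X A"
  by (auto simp: grow_def)

lemma finite_grow [simp]: "finite A \<Longrightarrow> finite (grow (X :: 'n::finite set) A)"
  by (simp add: grow_def)

lemma grow_mono: "A \<subseteq> B \<Longrightarrow> grow X A \<subseteq> grow X B"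
  by (auto simp: grow_def)

lemma monsD_ev: "u \<in> mons X d \<Longrightarrow> i \<notin> X \<Longrightarrow> ev u i = 0"
  by (auto simp: mons_def in_keys_iff)

lemma mons_iff_ev: "u \<in> mons X d \<longleftrightarrow> (\<forall>i. i \<notin> X \<longrightarrow> ev u i = 0) \<and> mdeg u = d"
  by (auto simp: mons_def in_keys_iff)

lemma grow_mons: "A \<subseteq> mons X d \<Longrightarrow> grow X A \<subseteq> mons X (Suc d)"
proof -
  assume A: "A \<subseteq> mons X d"
  have "ex i + u \<in> mons X (Suc d)" if "i \<in> X" "u \<in> A" for i u
  proof -
    have "u \<in> mons X d" "i \<in> X" using that A by auto
    then show ?thesis by (auto simp: mons_iff_ev lookup_add lookup_single when_def)
  qed
  then show "grow X A \<subseteq> mons X (Suc d)" by (auto simp: grow_def)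
qed

text \<open>If \<open>T\<close> consists of all monomials of some degree, these are the lex segments.\<close>

definition upper_in :: "'a::linorder set \<Rightarrow> 'a set \<Rightarrow> bool" where
  "upper_in T L \<longleftrightarrow> L \<subseteq> T \<and> (\<forall>u\<in>L. \<forall>v\<in>T. u < v \<longrightarrow> v \<in> L)"

lemma upper_in_chain: "upper_in T A \<Longrightarrow> upper_in T B \<Longrightarrow> A \<subseteq> B \<or> B \<subseteq> A"
proof (rule ccontr)
  assume A: "upper_in T A" and B: "upper_in T B" and "\<not> (A \<subseteq> B \<or> B \<subseteq> A)"
  then obtain a b where ab: "a \<in> A" "a \<notin> B" "b \<in> B" "b \<notin> A" by blast
  then have "a \<in> T" "b \<in> T" using A B by (auto simp: upper_in_def)
  then show False using ab A B unfolding upper_in_def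
    by (cases a b rule: linorder_cases) blast+
qed

lemma upper_in_card_subset:
  assumes "finite T" "upper_in T A" "upper_in T B" "card A \<le> card B"
  shows "A \<subseteq> B"
proof -
  have "finite A" using assms by (meson finite_subset upper_in_def)
  then show ?thesis
    using upper_in_chain[OF assms(2,3)] assms(4) card_seteq[of A B] by auto
qed

lemma upper_in_exists:
  assumes "finite T" "k \<le> card T"
  obtains L where "upper_in T L" "card L = k"
proof -
  have "\<exists>L. upper_in T L \<and> card L = k" using assms
  proof (induction T rule: finite_linorder_min_induct)
    case empty then show ?case by (auto simp: upper_in_def)
  next
    case (insert b A)
    show ?case
    proof (cases "k \<le> card A")
      case True
      then obtain L where "upper_in A L" "card L = k" using insert by auto
      moreover have "b \<notin> L" "\<forall>u\<in>L. \<not> u < b"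
        using \<open>upper_in A L\<close> insert.hyps by (auto simp: upper_in_def dest: less_asym)
      ultimately show ?thesis by (intro exI[of _ L]) (auto simp: upper_in_def)
    next
      case False
      moreover have "card (insert b A) = Suc (card A)"
        using insert.hyps by (intro card_insert_disjoint) auto
      ultimately have "k = card (insert b A)" using insert.prems by simp
      then show ?thesis by (intro exI[of _ "insert b A"]) (auto simp: upper_in_def)
    qed
  qed
  then show ?thesis using that by auto
qed

text \<open>For \<open>v\<close> above a multiple of \<open>u \<in> L\<close>, cancel the last variable of \<open>v\<close>: among the
  divisors of \<open>v\<close> of degree one less this gives the largest one, and it is still at least \<open>u\<close>.\<close>

lemma upper_in_grow:
  fixes X :: "'n::{finite,linorder} set"
  assumes "upper_in (mons X d) L"
  shows "upper_in (mons X (Suc d)) (grow X L)"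
  unfolding upper_in_def
proof (intro conjI ballI impI)
  show "grow X L \<subseteq> mons X (Suc d)" using assms grow_mons by (auto simp: upper_in_def)
  fix w v assume w: "w \<in> grow X L" and v: "v \<in> mons X (Suc d)" and "w < v"
  obtain i u where u: "i \<in> X" "u \<in> L" "w = ex i + u" using w by (auto simp: grow_iff)
  have ud: "u \<in> mons X d" using u assms by (auto simp: upper_in_def)
  obtain m where m: "ev w m < ev v m" "\<And>j. j < m \<Longrightarrow> ev w j = ev v j"
    using \<open>w < v\<close> by (auto simp: monomial_less_iff)
  have uw: "ev u j \<le> ev w j" for j by (simp add: u lookup_add)
  define l where "l = Max (keys v)"
  have ne: "keys v \<noteq> {}" using v by (auto simp: mons_def mdeg_def)
  have l: "l \<in> keys v" unfolding l_def using ne by (intro Max_in) auto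
  have l_max: "ev v j = 0" if "j > l" for j
    using that unfolding l_def by (meson Max.coboundedI finite_keys in_keys_iff leD)
  have "m \<le> l" using l_max[of m] m(1) by (metis not_less0 not_le_imp_less)
  define v' where "v' = v - ex l"
  have split: "v = ex l + v'" unfolding v'_def using l
    by (intro monomial_split_off) (auto simp: in_keys_iff)
  have v'_other: "ev v' j = ev v j" if "j \<noteq> l" for j
    using that by (simp add: v'_def lookup_minus lookup_single)
  have v'_l: "ev v' l = ev v l - 1"
    by (simp add: v'_def lookup_minus)
  have "mdeg v = Suc (mdeg v')" by (subst split) simp
  moreover have "ev v' j = 0" if "j \<notin> X" for j
    using that v'_other[of j] monsD_ev[OF v] l v by (auto simp: mons_def)
  ultimately have v'd: "v' \<in> mons X d" using v by (simp add: mons_iff_ev)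
  have "u \<le> v'"
  proof (rule ccontr)
    assume "\<not> u \<le> v'"
    then obtain k where k: "ev v' k < ev u k" "\<And>j. j < k \<Longrightarrow> ev v' j = ev u j"
      by (auto simp: not_le monomial_less_iff)
    consider "k < m" | "k \<ge> m" "m < l" | "k = m" "m = l" | "k > l" "m = l"
      using \<open>m \<le> l\<close> by fastforce
    then show False
    proof cases
      case 1
      then show False using m(2)[of k] uw[of k] k(1) v'_other[of k] \<open>m \<le> l\<close> by auto
    next
      case 2
      then have "ev v' m \<le> ev u m" using k by (cases "k = m") auto
      then show False using 2 v'_other[of m] m(1) uw[of m] by auto
    next
      case 3
      then show False using v'_l m(1) uw[of l] k(1) by auto
    next
      case 4
      have "ev v' j \<le> ev u j" for j
        using k(2)[of j] l_max[of j] v'_other[of j] 4 by (cases "j < k") auto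
      then have "mdeg v' < mdeg u" using k(1) by (intro mdeg_strict_mono) auto
      then show False using v'd ud by (simp add: mons_def)
    qed
  qed
  then have "v' \<in> L" using assms u v'd by (cases "u = v'") (auto simp: upper_in_def)
  moreover have "l \<in> X" using l v by (auto simp: mons_def)
  ultimately show "v \<in> grow X L" unfolding grow_iff using split by blast
qed

section \<open>Macaulay's theorem for sets of monomials\<close>

text \<open>
  For a set \<open>C\<close> of monomials of one degree and two variables \<open>y\<close> and \<open>z\<close>, the fibre of \<open>u\<close> consists of
  the members of \<open>C\<close> with the same exponents as \<open>u\<close> except possibly at \<open>y\<close> and \<open>z\<close>. A member of
  a fibre is determined by its \<open>z\<close>-exponent. The map \<open>push\<close> replaces the \<open>z\<close>-exponents of each
  fibre by their ranks \<open>0, 1, 2, \<dots>\<close> and corrects the \<open>y\<close>-exponents to keep the degree.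
\<close>

definition agree_off :: "'n \<Rightarrow> 'n \<Rightarrow> 'n monomial \<Rightarrow> 'n monomial \<Rightarrow> bool" where
  "agree_off y z u v \<longleftrightarrow> (\<forall>l. l \<noteq> y \<longrightarrow> l \<noteq> z \<longrightarrow> ev u l = ev v l)"

definition fib :: "'n \<Rightarrow> 'n \<Rightarrow> 'n monomial set \<Rightarrow> 'n monomial \<Rightarrow> 'n monomial set" where
  "fib y z C u = {v \<in> C. agree_off y z v u}"

definition fib_rank :: "'n \<Rightarrow> 'n \<Rightarrow> 'n monomial set \<Rightarrow> 'n monomial \<Rightarrow> nat" where
  "fib_rank y z C u = card {v \<in> fib y z C u. ev v z < ev u z}"

definition push :: "'n \<Rightarrow> 'n \<Rightarrow> 'n monomial set \<Rightarrow> 'n monomial \<Rightarrow> 'n monomial" where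
  "push y z C u = Poly_Mapping.update z (fib_rank y z C u)
     (Poly_Mapping.update y (ev u y + ev u z - fib_rank y z C u) u)"

lemma agree_off_eq:
  fixes u v :: "'n::finite monomial"
  assumes "agree_off y z u v" "ev u z = ev v z" "mdeg u = mdeg v"
  shows "u = v"
proof (rule poly_mapping_eqI)
  have "sum (ev u) (UNIV - {y}) = sum (ev v) (UNIV - {y})"
    using assms(1,2) by (intro sum.cong) (auto simp: agree_off_def)
  then have "ev u y = ev v y"
    using assms(3) unfolding mdeg_def by (simp add: sum.remove[of UNIV y])
  then show "ev u l = ev v l" for l using assms by (cases "l = y \<or> l = z") (auto simp: agree_off_def)
qed

lemma agree_off_sym: "agree_off y z u v \<Longrightarrow> agree_off y z v u"
  by (auto simp: agree_off_def)

lemma agree_off_trans: "agree_off y z u v \<Longrightarrow> agree_off y z v w \<Longrightarrow> agree_off y z u w"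
  by (auto simp: agree_off_def)

lemma fib_cong: "agree_off y z u v \<Longrightarrow> fib y z C u = fib y z C v"
  unfolding fib_def by (auto intro: agree_off_trans agree_off_sym)

lemma rank_image_lessThan:
  fixes T :: "nat set"
  assumes "finite T"
  shows "(\<lambda>t. card {s \<in> T. s < t}) ` T = {..<card T}"
proof (rule card_subset_eq)
  show "(\<lambda>t. card {s \<in> T. s < t}) ` T \<subseteq> {..<card T}"
    using assms by (auto intro!: psubset_card_mono)
  have "inj_on (\<lambda>t. card {s \<in> T. s < t}) T"
  proof (rule linorder_inj_onI')
    fix i j assume "i \<in> T" "j \<in> T" "i < j"
    then have "card {s \<in> T. s < i} < card {s \<in> T. s < j}"
      using assms by (intro psubset_card_mono) auto
    then show "card {s \<in> T. s < i} \<noteq> card {s \<in> T. s < j}" by simp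
  qed
  then show "card ((\<lambda>t. card {s \<in> T. s < t}) ` T) = card {..<card T}"
    by (simp add: card_image)
qed simp

context
  fixes X :: "'n::finite set" and y z :: 'n and d :: nat and C :: "'n monomial set"
  assumes C: "C \<subseteq> mons X d" and yz: "y \<noteq> z" "y \<in> X" "z \<in> X"
begin

lemma finite_C: "finite C"
  using C finite_subset finite_mons by blast

lemma finite_fib: "finite (fib y z C u)"
  using finite_C by (simp add: fib_def)

lemma inj_on_fib: "inj_on (\<lambda>v. ev v z) (fib y z C u)"
proof (rule inj_onI)
  fix v w assume vw: "v \<in> fib y z C u" "w \<in> fib y z C u" "ev v z = ev w z"
  then have "agree_off y z v w" by (auto simp: fib_def intro: agree_off_trans agree_off_sym)
  moreover have "mdeg v = mdeg w" using vw C by (auto simp: fib_def mons_def)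
  ultimately show "v = w" using vw(3) agree_off_eq by blast
qed

lemma fib_rank_eq:
  "fib_rank y z C u = card {s \<in> (\<lambda>v. ev v z) ` fib y z C u. s < ev u z}"
proof -
  have "{s \<in> (\<lambda>v. ev v z) ` fib y z C u. s < ev u z}
      = (\<lambda>v. ev v z) ` {v \<in> fib y z C u. ev v z < ev u z}" by auto
  moreover have "inj_on (\<lambda>v. ev v z) {v \<in> fib y z C u. ev v z < ev u z}"
    using inj_on_fib by (rule inj_on_subset) auto
  ultimately show ?thesis by (simp add: fib_rank_def card_image)
qed

lemma fib_rank_le: "fib_rank y z C u \<le> ev u z"
  unfolding fib_rank_eq using card_mono[of "{..<ev u z}"] by (simp add: subset_eq)

lemma fib_rank_less:
  assumes "u \<in> C" "ev u z > 0" "u - ex z + ex y \<notin> C"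
  shows "fib_rank y z C u < ev u z"
proof -
  have "v \<notin> fib y z C u" if "ev v z = ev u z - 1" for v
  proof
    assume v: "v \<in> fib y z C u"
    have "u - ex z + ex y = v"
    proof (rule agree_off_eq)
      show "agree_off y z (u - ex z + ex y) v"
        using v by (auto simp: agree_off_def fib_def lookup_add lookup_minus lookup_single when_def)
      show "ev (u - ex z + ex y) z = ev v z"
        using that yz by (simp add: lookup_add lookup_minus lookup_single)
      show "mdeg (u - ex z + ex y) = mdeg v"
        using v C assms exponent_le_mdeg[of u z] by (auto simp: mdeg_diff_ex fib_def mons_def)
    qed
    then show False using v assms by (simp add: fib_def)
  qed
  then have sub: "{s \<in> (\<lambda>v. ev v z) ` fib y z C u. s < ev u z} \<subseteq> {..<ev u z} - {ev u z - 1}"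
    by auto
  have "fib_rank y z C u \<le> card ({..<ev u z} - {ev u z - 1})"
    unfolding fib_rank_eq by (rule card_mono[OF _ sub]) simp
  then show ?thesis using assms(2) by simp
qed

lemma ev_push_z: "ev (push y z C u) z = fib_rank y z C u"
  by (simp add: push_def lookup_update)

lemma agree_off_push: "agree_off y z (push y z C u) u"
  by (simp add: push_def agree_off_def lookup_update)

lemma push_in_mons: "u \<in> C \<Longrightarrow> push y z C u \<in> mons X d"
proof -
  assume u: "u \<in> C"
  have "mdeg (push y z C u) + ev (Poly_Mapping.update y (ev u y + ev u z - fib_rank y z C u) u) z
      = mdeg (Poly_Mapping.update y (ev u y + ev u z - fib_rank y z C u) u) + fib_rank y z C u"
    unfolding push_def by (rule mdeg_update)
  moreover have "mdeg (Poly_Mapping.update y (ev u y + ev u z - fib_rank y z C u) u) + ev u y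
      = mdeg u + (ev u y + ev u z - fib_rank y z C u)" by (rule mdeg_update)
  ultimately have "mdeg (push y z C u) = mdeg u"
    using yz fib_rank_le[of u] by (simp add: lookup_update)
  moreover have "ev (push y z C u) i = 0" if "i \<notin> X" for i
    using that agree_off_push[of u] yz monsD_ev[of u X d i] subsetD[OF C u]
    by (metis agree_off_def)
  ultimately show ?thesis using u C by (auto simp: mons_iff_ev)
qed

lemma fib_rank_image: "fib_rank y z C ` fib y z C u = {..<card (fib y z C u)}"
proof -
  let ?T = "(\<lambda>v. ev v z) ` fib y z C u"
  have "fib_rank y z C v = card {s \<in> ?T. s < ev v z}" if "v \<in> fib y z C u" for v
    using that fib_cong[of y z v u C] by (simp add: fib_rank_eq fib_def)
  then have "fib_rank y z C ` fib y z C u = (\<lambda>t. card {s \<in> ?T. s < t}) ` ?T"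
    by (simp add: image_image)
  also have "\<dots> = {..<card ?T}" using finite_fib by (intro rank_image_lessThan) auto
  also have "card ?T = card (fib y z C u)" by (simp add: card_image inj_on_fib)
  finally show ?thesis .
qed

lemma self_fib: "u \<in> C \<Longrightarrow> u \<in> fib y z C u"
  by (simp add: fib_def agree_off_def)

lemma inj_on_push: "inj_on (push y z C) C"
proof (rule inj_onI)
  fix u v assume u: "u \<in> C" and v: "v \<in> C" and eq: "push y z C u = push y z C v"
  have ag: "agree_off y z u v"
    using agree_off_push[of u] agree_off_push[of v] eq by (metis agree_off_sym agree_off_trans)
  have "inj_on (fib_rank y z C) (fib y z C v)"
    by (rule eq_card_imp_inj_on) (simp_all add: finite_fib fib_rank_image)
  moreover have "fib_rank y z C u = fib_rank y z C v" using eq ev_push_z by metis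
  moreover have "u \<in> fib y z C v" "v \<in> fib y z C v" using u v ag by (auto simp: fib_def agree_off_def)
  ultimately show "u = v" by (auto dest: inj_onD)
qed

lemma push_image: "push y z C ` C = {u \<in> mons X d. ev u z < card (fib y z C u)}"
proof (intro equalityI subsetI)
  fix w assume "w \<in> push y z C ` C"
  then obtain u where u: "u \<in> C" "w = push y z C u" by auto
  have "fib_rank y z C u \<in> {..<card (fib y z C u)}"
    using self_fib[OF u(1)] fib_rank_image by blast
  then show "w \<in> {u \<in> mons X d. ev u z < card (fib y z C u)}"
    using u push_in_mons fib_cong[OF agree_off_push[of u]] by (auto simp: ev_push_z)
next
  fix w assume "w \<in> {u \<in> mons X d. ev u z < card (fib y z C u)}"
  then have w: "w \<in> mons X d" "ev w z \<in> fib_rank y z C ` fib y z C w"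
    by (auto simp: fib_rank_image)
  then obtain v where v: "v \<in> fib y z C w" "fib_rank y z C v = ev w z" by auto
  have vC: "v \<in> C" using v by (simp add: fib_def)
  have "push y z C v = w"
  proof (rule agree_off_eq)
    show "agree_off y z (push y z C v) w"
      using agree_off_push[of v] v by (auto simp: fib_def intro: agree_off_trans)
    show "mdeg (push y z C v) = mdeg w"
      using push_in_mons[OF vC] w by (simp add: mons_def)
  qed (simp add: ev_push_z v)
  then show "w \<in> push y z C ` C" using vC by auto
qed

end

text \<open>
  After pushing, a fibre is an initial segment of \<open>z\<close>-exponents, so it is determined by its size. Hence
  it suffices that every fibre of \<open>grow X C\<close> is large enough: it contains a translate of the fibres of
  \<open>C\<close> it comes from, and one more element if it comes from a fibre by multiplication with \<open>y\<close> and \<open>z\<close>.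
\<close>

lemma grow_push:
  fixes X :: "'n::finite set"
  assumes C: "C \<subseteq> mons X d" and yz: "y \<noteq> z" "y \<in> X" "z \<in> X"
  shows "grow X (push y z C ` C) \<subseteq> push y z (grow X C) ` grow X C"
proof
  note CS = grow_mons[OF C]
  let ?D = "grow X C"
  have finD: "finite (fib y z ?D u)" for u using finite_fib[OF CS yz] .
  fix w assume "w \<in> grow X (push y z C ` C)"
  then obtain i u where iu: "i \<in> X" "u \<in> mons X d" "ev u z < card (fib y z C u)" "w = ex i + u"
    by (auto simp: grow_iff push_image[OF C yz])
  have wm: "w \<in> mons X (Suc d)"
    using grow_mons[of "{u}" X d] iu by (auto simp: grow_def)
  have shift: "(+) (ex i) ` fib y z C u \<subseteq> fib y z ?D w"
    using iu by (auto simp: fib_def agree_off_def lookup_add intro: growI)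
  have c_le: "card (fib y z C u) \<le> card (fib y z ?D w)"
    using card_mono[OF finD shift] by (simp add: card_image)
  have "ev w z < card (fib y z ?D w)"
  proof (cases "i = z")
    case False
    then show ?thesis using iu(3,4) c_le by (simp add: lookup_add lookup_single)
  next
    case True
    let ?F = "fib y z C u"
    \<comment> \<open>multiplying by \<open>y\<close> keeps the set of \<open>z\<close>-exponents of the fibre, and
      the largest of them can be raised by one\<close>
    have F: "finite ?F" "?F \<noteq> {}" using iu(3) finite_fib[OF C yz] by (auto simp: card_gt_0_iff)
    have "Max ((\<lambda>v. ev v z) ` ?F) \<in> (\<lambda>v. ev v z) ` ?F" using F by (intro Max_in) auto
    then obtain t where t: "t \<in> ?F" "ev t z = Max ((\<lambda>v. ev v z) ` ?F)" by auto
    have t_max: "ev v z \<le> ev t z" if "v \<in> ?F" for v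
      unfolding t(2) using that F(1) by (intro Max_ge) auto
    have "ex z + t \<notin> (+) (ex y) ` ?F"
    proof
      assume "ex z + t \<in> (+) (ex y) ` ?F"
      then obtain v where "v \<in> ?F" and eq: "ex z + t = ex y + v" by auto
      have "ev v z = Suc (ev t z)"
        using yz(1) arg_cong[OF eq, of "\<lambda>m. ev m z"]
        by (simp add: lookup_add lookup_single_not_eq)
      then show False using t_max[OF \<open>v \<in> ?F\<close>] by simp
    qed
    moreover have "insert (ex z + t) ((+) (ex y) ` ?F) \<subseteq> fib y z ?D w"
      using t(1) yz iu True
      by (auto simp: fib_def agree_off_def lookup_add lookup_single intro: growI)
    ultimately have "Suc (card ?F) \<le> card (fib y z ?D w)"
      using card_mono[OF finD, of "insert (ex z + t) ((+) (ex y) ` ?F)" w] F by (simp add: card_image)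
    then show ?thesis using iu True by (simp add: lookup_add)
  qed
  then show "w \<in> push y z ?D ` ?D" unfolding push_image[OF CS yz] using wm by simp
qed

text \<open>Pushing the exponents of \<open>z\<close> to \<open>y\<close> lowers the total exponent of \<open>z\<close>, so it stops at a set
  that is stable with respect to \<open>z\<close>.\<close>

lemma stable_set_exists:
  fixes X :: "'n::finite set"
  assumes "C \<subseteq> mons X d" "z \<in> X"
  shows "\<exists>C'\<subseteq>mons X d. card C' = card C \<and> card (grow X C') \<le> card (grow X C) \<and>
     (\<forall>u\<in>C'. \<forall>y\<in>X. ev u z > 0 \<longrightarrow> u - ex z + ex y \<in> C')"
  using assms(1)
proof (induction "\<Sum>u\<in>C. ev u z" arbitrary: C rule: less_induct)
  case less
  note C = \<open>C \<subseteq> mons X d\<close>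
  have fin: "finite C" using C finite_subset finite_mons by blast
  show ?case
  proof (cases "\<forall>u\<in>C. \<forall>y\<in>X. ev u z > 0 \<longrightarrow> u - ex z + ex y \<in> C")
    case True
    then show ?thesis using C by blast
  next
    case False
    then obtain u y where u: "u \<in> C" "y \<in> X" "ev u z > 0" "u - ex z + ex y \<notin> C" by blast
    have "y \<noteq> z"
    proof
      assume "y = z"
      then have "u - ex z + ex y = u" using monomial_split_off[OF u(3)] by (simp add: add.commute)
      then show False using u by simp
    qed
    note yz = this u(2) assms(2)
    let ?C = "push y z C ` C"
    have "(\<Sum>v\<in>?C. ev v z) = (\<Sum>v\<in>C. fib_rank y z C v)"
      by (simp add: sum.reindex[OF inj_on_push[OF C yz]] ev_push_z[OF C yz])
    also have "\<dots> < (\<Sum>v\<in>C. ev v z)"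
      using fib_rank_le[OF C yz] fib_rank_less[OF C yz u(1,3,4)] u(1)
      by (intro sum_strict_mono_ex1[OF fin]) auto
    finally have lt: "(\<Sum>v\<in>?C. ev v z) < (\<Sum>v\<in>C. ev v z)" .
    have sub: "?C \<subseteq> mons X d" using push_in_mons[OF C yz] by auto
    have cc: "card ?C = card C" by (simp add: card_image[OF inj_on_push[OF C yz]])
    have "card (grow X ?C) \<le> card (push y z (grow X C) ` grow X C)"
      using grow_push[OF C yz] fin by (intro card_mono) auto
    also have "\<dots> \<le> card (grow X C)" using fin by (intro card_image_le) auto
    finally show ?thesis using less.hyps[OF lt sub] cc by (metis order_trans)
  qed
qed


text \<open>If \<open>L\<close> is stable with respect to \<open>z\<close>, then \<open>x\<^sub>i * u\<close> with \<open>z\<close> dividing \<open>u\<close> is also \<open>z\<close>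
  times a member of \<open>L\<close>, so beyond \<open>z * L\<close> only the growth of the \<open>z\<close>-free part is new.\<close>

lemma card_grow_stable_le:
  fixes X :: "'n::finite set"
  assumes "finite L" "\<And>u i. u \<in> L \<Longrightarrow> i \<in> A \<Longrightarrow> ev u z > 0 \<Longrightarrow> u - ex z + ex i \<in> L"
    and "L \<subseteq> mons (insert z A) d"
  shows "card (grow (insert z A) L) \<le> card L + card (grow A (L \<inter> mons A d))"
proof -
  have "grow (insert z A) L \<subseteq> (+) (ex z) ` L \<union> grow A (L \<inter> mons A d)"
  proof
    fix w assume "w \<in> grow (insert z A) L"
    then obtain i u where iu: "i \<in> insert z A" "u \<in> L" "w = ex i + u" by (auto simp: grow_iff)
    have um: "u \<in> mons (insert z A) d" using iu(2) assms(3) by auto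
    show "w \<in> (+) (ex z) ` L \<union> grow A (L \<inter> mons A d)"
    proof (cases "i = z")
      case True
      then show ?thesis using iu by auto
    next
      case False
      then have iA: "i \<in> A" using iu by auto
      show ?thesis
      proof (cases "ev u z > 0")
        case True
        have "w = ex z + (u - ex z + ex i)"
          using monomial_split_off[OF True] iu(3) by (metis add.assoc add.commute)
        then show ?thesis using assms(2)[OF iu(2) iA True] by blast
      next
        case False
        then have "u \<in> mons A d" using um unfolding mons_iff_ev by (metis insert_iff not_gr_zero)
        then show ?thesis using iu iA by (auto intro: growI)
      qed
    qed
  qed
  then have "card (grow (insert z A) L) \<le> card ((+) (ex z) ` L \<union> grow A (L \<inter> mons A d))"
    using assms(1) by (intro card_mono) auto
  also have "\<dots> \<le> card ((+) (ex z) ` L) + card (grow A (L \<inter> mons A d))" by (rule card_Un_le)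
  finally show ?thesis by (simp add: card_image)
qed

lemma card_grow_ge:
  fixes A :: "'n::finite set"
  assumes "finite C" "z \<notin> A"
  shows "card C + card (grow A (C \<inter> mons A d)) \<le> card (grow (insert z A) C)"
proof -
  have "ev w z = 0" if "w \<in> grow A (C \<inter> mons A d)" for w
    using that assms(2) by (auto simp: grow_iff mons_iff_ev lookup_add lookup_single when_def)
  then have "(+) (ex z) ` C \<inter> grow A (C \<inter> mons A d) = {}"
    by (fastforce simp: lookup_add)
  then have "card ((+) (ex z) ` C \<union> grow A (C \<inter> mons A d)) = card C + card (grow A (C \<inter> mons A d))"
    using assms(1) by (simp add: card_Un_disjoint card_image)
  moreover have "(+) (ex z) ` C \<union> grow A (C \<inter> mons A d) \<subseteq> grow (insert z A) C"
    by (auto simp: grow_def)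
  ultimately show ?thesis using assms(1) by (metis card_mono finite_grow)
qed

text \<open>Replacing the last variable \<open>z\<close> of a monomial by the previous one \<open>y\<close> does not affect a comparison
  with a \<open>z\<close>-free monomial of the same degree, because such a comparison is decided before \<open>y\<close>.\<close>

lemma less_replace_last:
  fixes A :: "'n::{finite,linorder} set"
  assumes "\<And>i. i \<in> A \<Longrightarrow> i \<le> y" "y < z" "w \<in> mons A d" "u + Poly_Mapping.single y j \<in> mons A d"
    and "w < u + Poly_Mapping.single y j"
  shows "w < u + Poly_Mapping.single z j"
proof -
  define v where "v = u + Poly_Mapping.single y j"
  have v: "v \<in> mons A d" "w < v" using assms(4,5) by (auto simp: v_def)
  obtain i where i: "ev w i < ev v i" "\<And>k. k < i \<Longrightarrow> ev w k = ev v k"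
    using v by (auto simp: monomial_less_iff)
  have "i \<noteq> y"
  proof
    assume "i = y"
    have "ev w k \<le> ev v k" for k
      using i(1) i(2)[of k] \<open>i = y\<close> assms(1)[of k] monsD_ev[OF assms(3), of k] leD[of k y]
      by (cases "k \<in> A"; cases k y rule: linorder_cases) simp_all
    then have "mdeg w < mdeg v" using i(1) by (intro mdeg_strict_mono) auto
    then show False using v assms(3) by (simp add: mons_def)
  qed
  moreover have "i \<in> A" using i(1) monsD_ev[OF v(1), of i] by auto
  ultimately have iy: "i < y" using assms(1)[of i] by auto
  have "ev (u + Poly_Mapping.single z j) k = ev v k" if "k \<le> i" for k
    using that iy assms(2) by (auto simp: v_def lookup_add lookup_single when_def)
  then show ?thesis unfolding monomial_less_iff using i by (intro exI[of _ i]) auto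
qed

text \<open>The members of \<open>C\<close> with \<open>z\<close>-exponent \<open>j\<close>, divided by \<open>z ^ j\<close>.\<close>

definition slice :: "'n::finite \<Rightarrow> 'n set \<Rightarrow> nat \<Rightarrow> 'n monomial set \<Rightarrow> nat \<Rightarrow> 'n monomial set" where
  "slice z A d C j = {u \<in> mons A (d - j). u + Poly_Mapping.single z j \<in> C}"

lemma card_Union_slices:
  assumes "z \<notin> A" "\<And>j. j \<le> d \<Longrightarrow> M j \<subseteq> mons A (d - j)"
  shows "card (\<Union>j\<le>d. (\<lambda>u. u + Poly_Mapping.single z j) ` M j) = (\<Sum>j\<le>d. card (M j))"
proof (subst card_UN_disjoint)
  show "\<forall>i\<in>{..d}. finite ((\<lambda>u. u + Poly_Mapping.single z i) ` M i)"
    using assms(2) finite_subset finite_mons by (metis atMost_iff finite_imageI)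
  have *: "ev v z = j" if "v \<in> (\<lambda>u. u + Poly_Mapping.single z j) ` M j" "j \<le> d" for v j
    using that assms by (auto simp: lookup_add mons_iff_ev subset_iff)
  show "\<forall>i\<in>{..d}. \<forall>j\<in>{..d}. i \<noteq> j \<longrightarrow> (\<lambda>u. u + Poly_Mapping.single z i) ` M i
      \<inter> (\<lambda>u. u + Poly_Mapping.single z j) ` M j = {}"
    using * by (metis atMost_iff disjoint_iff)
  show "(\<Sum>i\<le>d. card ((\<lambda>u. u + Poly_Mapping.single z i) ` M i)) = (\<Sum>j\<le>d. card (M j))"
    by (intro sum.cong) (auto simp: card_image)
qed auto

lemma Union_slices:
  assumes "C \<subseteq> mons (insert z A) d"
  shows "C = (\<Union>j\<le>d. (\<lambda>u. u + Poly_Mapping.single z j) ` slice z A d C j)"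
proof (intro equalityI subsetI)
  fix v assume v: "v \<in> C"
  define u where "u = v - Poly_Mapping.single z (ev v z)"
  have split: "v = u + Poly_Mapping.single z (ev v z)"
    by (intro poly_mapping_eqI) (auto simp: u_def lookup_add lookup_minus lookup_single when_def)
  have vm: "v \<in> mons (insert z A) d" using v assms by auto
  have dv: "d = mdeg u + ev v z"
    using vm arg_cong[OF split, of mdeg] unfolding mdeg_add mdeg_single by (simp add: mons_def)
  have "u \<in> mons A (d - ev v z)"
    using vm dv by (auto simp: mons_iff_ev u_def lookup_minus lookup_single when_def)
  then have "u \<in> slice z A d C (ev v z)" using split v by (auto simp: slice_def)
  then show "v \<in> (\<Union>j\<le>d. (\<lambda>u. u + Poly_Mapping.single z j) ` slice z A d C j)"
    using split dv by (intro UN_I[of "ev v z"]) auto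
qed (auto simp: slice_def)

text \<open>
  Induction on the number of variables, following Bigatti. By pushing, \<open>C\<close> may be taken stable
  with respect to the last variable \<open>z\<close>; the growth is then at least \<open>card C\<close> plus the growth
  of the \<open>z\<close>-free part of \<open>C\<close>, with equality for the segment \<open>L\<close>. So the claim is that the
  \<open>z\<close>-free part of \<open>L\<close> is at most as large as that of \<open>C\<close>. Replace each slice of \<open>C\<close> by a
  segment \<open>M j\<close>; by induction the new set is still stable. If it missed some \<open>z\<close>-free \<open>w \<in> L\<close>,
  all of it would lie above \<open>w\<close>, hence in \<open>L\<close>, and \<open>L\<close> would be larger than \<open>C\<close>.
\<close>

theorem Macaulay_monomials:
  fixes X :: "'n::{finite,linorder} set"
  assumes "C \<subseteq> mons X d" "upper_in (mons X d) L" "card L \<le> card C"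
  shows "card (grow X L) \<le> card (grow X C)"
proof -
  have "\<forall>d C L. C \<subseteq> mons X d \<longrightarrow> upper_in (mons X d) L \<longrightarrow> card L \<le> card C \<longrightarrow>
    card (grow X L) \<le> card (grow X C)" (is "?P X")
    using finite[of X]
  proof (induction X rule: finite_linorder_max_induct)
    case empty
    then show ?case by (simp add: grow_def)
  next
    case (insert z A)
    note IH = insert.IH[rule_format]
    have zA: "z \<notin> A" using insert.hyps by auto
    let ?X = "insert z A"
    show ?case
    proof (intro allI impI)
      fix d C L assume C0: "C \<subseteq> mons ?X d" and L: "upper_in (mons ?X d) L" and LC0: "card L \<le> card C"
      obtain C' where C': "C' \<subseteq> mons ?X d" "card C' = card C" "card (grow ?X C') \<le> card (grow ?X C)"
        and stable: "\<And>u y. u \<in> C' \<Longrightarrow> y \<in> ?X \<Longrightarrow> ev u z > 0 \<Longrightarrow> u - ex z + ex y \<in> C'"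
        using stable_set_exists[OF C0, of z] by auto
      have finC': "finite C'" and finL: "finite L"
        using C' L finite_mons finite_subset unfolding upper_in_def by blast+
      have LC: "card L \<le> card C'" using LC0 C' by simp
      have Lm: "L \<subseteq> mons ?X d" using L by (auto simp: upper_in_def)
      let ?S = "slice z A d C'"
      have "\<exists>M. upper_in (mons A (d - j)) M \<and> card M = card (?S j)" for j
        by (rule upper_in_exists[of "mons A (d - j)" "card (?S j)"])
          (auto simp: slice_def intro!: card_mono)
      then obtain M where M: "\<And>j. upper_in (mons A (d - j)) (M j)" "\<And>j. card (M j) = card (?S j)"
        by metis
      have Mm: "M j \<subseteq> mons A (d - j)" for j using M(1)[of j] by (auto simp: upper_in_def)
      have M_step: "grow A (M (Suc j)) \<subseteq> M j" if "Suc j \<le> d" for j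
      proof -
        have dj: "Suc (d - Suc j) = d - j" using that by simp
        have "grow A (?S (Suc j)) \<subseteq> ?S j"
        proof
          fix w assume "w \<in> grow A (?S (Suc j))"
          then obtain i u where iu: "i \<in> A" "u \<in> mons A (d - Suc j)"
            "u + Poly_Mapping.single z (Suc j) \<in> C'" "w = ex i + u"
            by (auto simp: grow_iff slice_def)
          have "w \<in> mons A (d - j)"
            using grow_mons[of "{u}" A "d - Suc j"] iu dj by (auto simp: grow_def)
          moreover have "u + Poly_Mapping.single z (Suc j) - ex z + ex i \<in> C'"
            using iu by (intro stable) (auto simp: lookup_add)
          moreover have "u + Poly_Mapping.single z (Suc j) - ex z + ex i = w + Poly_Mapping.single z j"
            using iu(4) by (intro poly_mapping_eqI) (auto simp: lookup_add lookup_minus lookup_single when_def)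
          ultimately show "w \<in> ?S j" by (simp add: slice_def)
        qed
        then have "card (grow A (?S (Suc j))) \<le> card (?S j)"
          by (intro card_mono) (auto simp: slice_def)
        moreover have "card (grow A (M (Suc j))) \<le> card (grow A (?S (Suc j)))"
          by (rule IH[OF _ M(1)]) (auto simp: slice_def M(2))
        ultimately have "card (grow A (M (Suc j))) \<le> card (M j)" using M(2) by simp
        then show ?thesis
          using upper_in_card_subset[OF finite_mons _ M(1)[of j]] upper_in_grow[OF M(1)[of "Suc j"]]
          unfolding dj by blast
      qed
      have M_iter: "u + Poly_Mapping.single y j \<in> M 0" if "y \<in> A" "u \<in> M j" "j \<le> d" for u y j
        using that(2,3)
      proof (induction j arbitrary: u)
        case 0 then show ?case by simp
      next
        case (Suc j)
        have "ex y + u \<in> M j"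
          by (rule subsetD[OF M_step growI]) (use Suc.prems that(1) in simp_all)
        then have "ex y + u + Poly_Mapping.single y j \<in> M 0"
          by (rule Suc.IH) (use Suc.prems in simp)
        moreover have "ex y + u + Poly_Mapping.single y j = u + Poly_Mapping.single y (Suc j)"
          by (intro poly_mapping_eqI) (auto simp: lookup_add lookup_single when_def)
        ultimately show ?case by simp
      qed
      have L0: "upper_in (mons A d) (L \<inter> mons A d)"
      proof -
        have "mons A d \<subseteq> mons ?X d" by (auto simp: mons_def)
        then show ?thesis using L unfolding upper_in_def by blast
      qed
      have S0: "?S 0 = C' \<inter> mons A d" by (auto simp: slice_def)
      have "card (L \<inter> mons A d) \<le> card (C' \<inter> mons A d)"
      proof (rule ccontr)
        assume "\<not> ?thesis"
        then have gt: "card (M 0) < card (L \<inter> mons A d)" using M(2)[of 0] S0 by simp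
        then have M0L: "M 0 \<subseteq> L \<inter> mons A d"
          using upper_in_card_subset[OF finite_mons M(1)[of 0], of "L \<inter> mons A d"] L0 by simp
        then obtain w where w: "w \<in> L" "w \<in> mons A d" "w \<notin> M 0"
          using gt by (metis Int_iff less_irrefl subsetI subset_antisym)
        define M' where "M' = (\<Union>j\<le>d. (\<lambda>u. u + Poly_Mapping.single z j) ` M j)"
        have "M' \<subseteq> L"
        proof
          fix v assume "v \<in> M'"
          then obtain j u where ju: "j \<le> d" "u \<in> M j" "v = u + Poly_Mapping.single z j"
            by (auto simp: M'_def)
          show "v \<in> L"
          proof (cases "j = 0")
            case True
            then show ?thesis using ju M0L by auto
          next
            case False
            then have "A \<noteq> {}" using w(2) ju(1) by (auto simp: mons_def)
            define y where "y = Max A"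
            have y: "y \<in> A" "\<And>i. i \<in> A \<Longrightarrow> i \<le> y" using \<open>A \<noteq> {}\<close> by (auto simp: y_def)
            have v': "u + Poly_Mapping.single y j \<in> M 0" using M_iter y ju by blast
            then have v'm: "u + Poly_Mapping.single y j \<in> mons A d" using Mm[of 0] by auto
            have "w < u + Poly_Mapping.single y j"
              using M(1)[of 0] v' w(2,3) unfolding upper_in_def by (metis diff_zero linorder_less_linear)
            then have "w < v" using less_replace_last[OF y(2) _ w(2) v'm, of z] insert.hyps y(1) ju(3) by auto
            moreover have "v \<in> mons ?X d"
              using ju(1,3) subsetD[OF Mm ju(2)] by (auto simp: mons_iff_ev lookup_add lookup_single when_def)
            ultimately show ?thesis using L w(1) by (auto simp: upper_in_def)
          qed
        qed
        moreover have "w \<notin> M'"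
        proof
          assume "w \<in> M'"
          then obtain j u where ju: "j \<le> d" "u \<in> M j" "w = u + Poly_Mapping.single z j"
            by (auto simp: M'_def)
          then have "j = 0" using monsD_ev[OF w(2) zA] by (simp add: lookup_add)
          then show False using ju w(3) by simp
        qed
        ultimately have "M' \<subset> L" using w(1) by auto
        then have "card M' < card L" using finL by (rule psubset_card_mono[rotated])
        moreover have "card M' = (\<Sum>j\<le>d. card (M j))" unfolding M'_def
          by (rule card_Union_slices[OF zA Mm])
        moreover have "card C' = (\<Sum>j\<le>d. card (?S j))"
          by (subst Union_slices[OF C'(1)], rule card_Union_slices[OF zA]) (auto simp: slice_def)
        ultimately show False using LC M(2) by simp
      qed
      then have "card (grow A (L \<inter> mons A d)) \<le> card (grow A (C' \<inter> mons A d))"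
        by (intro IH[OF _ L0]) auto
      moreover have "card (grow ?X L) \<le> card L + card (grow A (L \<inter> mons A d))"
      proof (rule card_grow_stable_le[OF finL _ Lm])
        fix u i assume u: "u \<in> L" "i \<in> A" "ev u z > 0"
        have "i < z" using insert.hyps u by auto
        have "u < u - ex z + ex i" unfolding monomial_less_iff
          using \<open>i < z\<close> by (intro exI[of _ i]) (auto simp: lookup_add lookup_minus lookup_single when_def)
        moreover have "u - ex z + ex i \<in> mons ?X d"
          using u(2,3) subsetD[OF Lm u(1)] exponent_le_mdeg[of u z]
          by (auto simp: mons_iff_ev mdeg_diff_ex lookup_add lookup_minus lookup_single when_def)
        ultimately show "u - ex z + ex i \<in> L" using L u(1) by (auto simp: upper_in_def)
      qed
      moreover have "card C' + card (grow A (C' \<inter> mons A d)) \<le> card (grow ?X C')"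
        by (rule card_grow_ge[OF finC' zA])
      ultimately show "card (grow ?X L) \<le> card (grow ?X C)" using LC C'(3) by linarith
    qed
  qed
  then show ?thesis using assms by blast
qed

section \<open>Gluing sets of monomials\<close>

lemma grow_Un: "grow X (A \<union> B) = grow X A \<union> grow X B"
  by (auto simp: grow_def)

lemma grow_translate: "grow X ((+) c ` A) = (+) c ` grow X A"
  by (force simp: grow_def image_image add.left_commute)

lemma card_grow_singleton:
  fixes u :: "'n::finite monomial"
  shows "card (grow UNIV {u}) = CARD('n)"
proof -
  have "grow UNIV {u} = range (\<lambda>i. ex i + u)" by (auto simp: grow_def)
  moreover have "inj (\<lambda>i. ex i + u)"
  proof (rule injI)
    fix i j assume "ex i + u = ex j + u"
    then have "ev (ex i) i = ev (ex j) i" by simp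
    then show "i = j" by (simp add: lookup_single when_def split: if_splits)
  qed
  ultimately show ?thesis by (simp add: card_image)
qed

lemma card_grow_translate:
  fixes A :: "'n::finite monomial set"
  shows "card (grow X ((+) c ` A)) = card (grow X A)"
  by (simp add: grow_translate card_image)

text \<open>Translate the two sets so that the largest element of one becomes the smallest element of the
  other: then they overlap in that element only, and so the growths overlap at least in its growth.\<close>

lemma glue_two_sets:
  fixes A B :: "'n::{finite,linorder} monomial set"
  assumes A: "A \<subseteq> mons UNIV d" "A \<noteq> {}" and B: "B \<subseteq> mons UNIV e" "B \<noteq> {}"
  shows "\<exists>C :: 'n monomial set. C \<subseteq> mons UNIV (d + e) \<and> C \<noteq> {} \<and> card C + 1 = card A + card B \<and>
    card (grow UNIV C) + CARD('n) \<le> card (grow UNIV A) + card (grow UNIV B)"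
proof -
  have fin: "finite A" "finite B" using A B finite_mons finite_subset by blast+
  define a where "a = Max A"
  define b where "b = Min B"
  have a: "a \<in> A" "\<And>u. u \<in> A \<Longrightarrow> u \<le> a" and b: "b \<in> B" "\<And>u. u \<in> B \<Longrightarrow> b \<le> u"
    using fin A B by (auto simp: a_def b_def)
  define A' where "A' = (+) b ` A"
  define B' where "B' = (+) a ` B"
  have fin': "finite A'" "finite B'" using fin by (auto simp: A'_def B'_def)
  have 1: "a + b \<in> A'" "a + b \<in> B'" using a b by (auto simp: A'_def B'_def add.commute)
  have "w = a + b" if wA: "w \<in> A'" and wB: "w \<in> B'" for w
  proof (rule antisym)
    obtain u where "u \<in> A" "w = b + u" using wA unfolding A'_def by blast
    then show "w \<le> a + b" using a(2)[of u] by (simp add: add.commute[of a] add_left_mono)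
    obtain v where "v \<in> B" "w = a + v" using wB unfolding B'_def by blast
    then show "a + b \<le> w" using b(2)[of v] by (simp add: add_left_mono)
  qed
  then have int: "A' \<inter> B' = {a + b}" using 1 by blast
  have "card (A' \<union> B') + 1 = card A' + card B'"
    using card_Un_Int[OF fin'] int by simp
  moreover have "card A' = card A" "card B' = card B"
    by (simp_all add: A'_def B'_def card_image)
  moreover have "card (grow UNIV (A' \<union> B')) + CARD('n) \<le> card (grow UNIV A') + card (grow UNIV B')"
  proof -
    have "grow UNIV {a + b} \<subseteq> grow UNIV A' \<inter> grow UNIV B'"
      using 1 grow_mono[of "{a + b}" A' UNIV] grow_mono[of "{a + b}" B' UNIV] by auto
    then have "CARD('n) \<le> card (grow UNIV A' \<inter> grow UNIV B')"
      using fin' by (metis card_grow_singleton card_mono finite_Int finite_grow)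
    then show ?thesis using card_Un_Int[of "grow UNIV A'" "grow UNIV B'"] fin'
      by (simp add: grow_Un)
  qed
  moreover have "card (grow UNIV A') = card (grow UNIV A)" "card (grow UNIV B') = card (grow UNIV B)"
    by (simp_all add: A'_def B'_def card_grow_translate)
  moreover have "A' \<union> B' \<subseteq> mons UNIV (d + e)"
  proof -
    have "\<forall>u\<in>A. mdeg u = d" "\<forall>u\<in>B. mdeg u = e" using A(1) B(1) by (auto simp: mons_UNIV)
    then show ?thesis using a(1) b(1) by (auto simp: A'_def B'_def mons_UNIV)
  qed
  ultimately show ?thesis using 1 by (intro exI[of _ "A' \<union> B'"]) auto
qed

lemma glue_sets:
  fixes A :: "'j \<Rightarrow> 'n::{finite,linorder} monomial set"
  assumes "finite J" "J \<noteq> {}" "\<And>j. j \<in> J \<Longrightarrow> A j \<subseteq> mons UNIV (e j)" "\<And>j. j \<in> J \<Longrightarrow> A j \<noteq> {}"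
  shows "\<exists>C :: 'n monomial set. C \<subseteq> mons UNIV (\<Sum>j\<in>J. e j) \<and> C \<noteq> {} \<and> card C + card J = (\<Sum>j\<in>J. card (A j)) + 1 \<and>
    card (grow UNIV C) + CARD('n) * card J \<le> (\<Sum>j\<in>J. card (grow UNIV (A j))) + CARD('n)"
  using assms
proof (induction J rule: finite_ne_induct)
  case (singleton j)
  have "A j \<subseteq> mons UNIV (e j)" "A j \<noteq> {}" using singleton by auto
  then show ?case by (intro exI[of _ "A j"]) simp
next
  case (insert j J)
  have "\<exists>C :: 'n monomial set. C \<subseteq> mons UNIV (\<Sum>j\<in>J. e j) \<and> C \<noteq> {} \<and>
      card C + card J = (\<Sum>j\<in>J. card (A j)) + 1 \<and>
      card (grow UNIV C) + CARD('n) * card J \<le> (\<Sum>j\<in>J. card (grow UNIV (A j))) + CARD('n)"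
    by (rule insert.IH) (use insert.prems in simp_all)
  then obtain C :: "'n monomial set" where C: "C \<subseteq> mons UNIV (\<Sum>j\<in>J. e j)" "C \<noteq> {}"
    "card C + card J = (\<Sum>j\<in>J. card (A j)) + 1"
    "card (grow UNIV C) + CARD('n) * card J \<le> (\<Sum>j\<in>J. card (grow UNIV (A j))) + CARD('n)"
    by blast
  have Aj: "A j \<subseteq> mons UNIV (e j)" "A j \<noteq> {}" using insert.prems by auto
  obtain C' :: "'n monomial set" where C': "C' \<subseteq> mons UNIV (e j + (\<Sum>j\<in>J. e j))" "C' \<noteq> {}" "card C' + 1 = card (A j) + card C"
    "card (grow UNIV C') + CARD('n) \<le> card (grow UNIV (A j)) + card (grow UNIV C)"
    using glue_two_sets[OF Aj C(1,2)] by blast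
  have "card (insert j J) = Suc (card J)" using insert.hyps by simp
  moreover have "C' \<subseteq> mons UNIV (\<Sum>j\<in>insert j J. e j)" using C'(1) insert.hyps by simp
  moreover have "card C' + card (insert j J) = (\<Sum>j\<in>insert j J. card (A j)) + 1"
    using C(3) C'(3) insert.hyps by simp
  moreover have "card (grow UNIV C') + CARD('n) * card (insert j J)
      \<le> (\<Sum>j\<in>insert j J. card (grow UNIV (A j))) + CARD('n)"
    using C(4) C'(4) insert.hyps by simp
  ultimately show ?case using C'(2) by blast
qed

section \<open>Linear algebra in the polynomial ring\<close>

lemma keys_sum_subset: "keys (sum f A) \<subseteq> (\<Union>a\<in>A. keys (f a))"
proof (induction A rule: infinite_finite_induct)
  case (insert a A)
  then show ?case using keys_add[of "f a" "sum f A"] by auto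
qed auto

lemma poly_expand: "p = (\<Sum>v\<in>keys p. Poly_Mapping.single v (Poly_Mapping.lookup p v))"
  by (rule poly_mapping_eqI)
    (simp add: lookup_sum lookup_single when_def in_keys_iff)

lemma lookup_single_mult:
  fixes p :: "('n, 'k::comm_semiring_1) mpoly"
  shows "Poly_Mapping.lookup (Poly_Mapping.single u c * p) (u + v) = c * Poly_Mapping.lookup p v"
proof -
  have "Poly_Mapping.single u c * p = (\<Sum>w\<in>keys p. Poly_Mapping.single (u + w) (c * Poly_Mapping.lookup p w))"
    by (subst poly_expand[of p]) (simp add: sum_distrib_left mult_single)
  then show ?thesis
    by (simp add: lookup_sum lookup_single when_def in_keys_iff)
qed

lemma lookup_scale [simp]: "Poly_Mapping.lookup (scale c p) u = c * Poly_Mapping.lookup p u"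
  using lookup_single_mult[of 0 c p u] by (simp add: scale_def)

lemma keys_scale: "keys (scale c p) \<subseteq> keys p"
  by (auto simp: in_keys_iff)

lemma keys_monom_mult:
  "keys (monom u * p) = (+) u ` keys (p :: ('n, 'k::field) mpoly)"
proof
  show "keys (monom u * p) \<subseteq> (+) u ` keys p"
    using keys_mult[of "monom u" p] by (auto simp: monom_def split: if_splits)
  show "(+) u ` keys p \<subseteq> keys (monom u * p)"
    by (auto simp: monom_def in_keys_iff lookup_single_mult)
qed

lemma keys_monom [simp]: "keys (monom u :: ('n, 'k::field) mpoly) = {u}"
  by (simp add: monom_def)

lemma lookup_monom: "Poly_Mapping.lookup (monom u :: ('n, 'k::field) mpoly) v = (if u = v then 1 else 0)"
  by (simp add: monom_def lookup_single when_def)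

lemma monom_mult: "monom u * monom v = (monom (u + v) :: ('n, 'k::field) mpoly)"
  by (simp add: monom_def mult_single)

lemma monom_zero [simp]: "monom 0 = (1 :: ('n, 'k::field) mpoly)"
  by (simp add: monom_def)

lemma monom_nonzero [simp]: "monom u \<noteq> (0 :: ('n, 'k::field) mpoly)"
  using keys_monom[of u] by (metis insert_not_empty keys_zero)

lemma var_eq_monom: "var i = monom (ex i)"
  by (simp add: var_def)

lemma scale_mult_left: "scale c p * q = scale c (p * q :: ('n, 'k::field) mpoly)"
  unfolding scale_def by (rule mult.assoc)

lemma scale_mult_right: "p * scale c q = scale c (p * q :: ('n, 'k::field) mpoly)"
  unfolding scale_def by (rule mult.left_commute)

lemma poly_expand_monom:
  "p = (\<Sum>v\<in>keys p. scale (Poly_Mapping.lookup p v) (monom v))" for p :: "('n, 'k::field) mpoly"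
  by (subst poly_expand) (simp add: scale_def monom_def mult_single)

lemma subspace_keys: "mpoly.subspace {p :: ('n, 'k::field) mpoly. keys p \<subseteq> T}"
proof (rule mpoly.subspaceI)
  fix x y :: "('n, 'k) mpoly" and c :: 'k
  assume "x \<in> {p. keys p \<subseteq> T}"
  then show "scale c x \<in> {p. keys p \<subseteq> T}" using keys_scale[of c x] by auto
  assume "y \<in> {p. keys p \<subseteq> T}"
  then show "x + y \<in> {p. keys p \<subseteq> T}" using \<open>x \<in> _\<close> keys_add[of x y] by auto
qed simp

lemma span_monoms: "mpoly.span (monom ` T) = {p :: ('n, 'k::field) mpoly. keys p \<subseteq> T}"
proof
  show "mpoly.span (monom ` T) \<subseteq> {p :: ('n, 'k::field) mpoly. keys p \<subseteq> T}"
    by (intro mpoly.span_minimal subspace_keys) auto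
  show "{p :: ('n, 'k::field) mpoly. keys p \<subseteq> T} \<subseteq> mpoly.span (monom ` T)"
  proof
    fix p :: "('n, 'k) mpoly" assume "p \<in> {p. keys p \<subseteq> T}"
    then have "(\<Sum>v\<in>keys p. scale (Poly_Mapping.lookup p v) (monom v)) \<in> mpoly.span (monom ` T)"
      by (intro mpoly.span_sum mpoly.span_scale mpoly.span_base) auto
    then show "p \<in> mpoly.span (monom ` T)" using poly_expand_monom[of p] by simp
  qed
qed

text \<open>Independence of a family: a repeated member counts as a dependence, so that index sets can be
  compared in size without any injectivity assumption.\<close>

definition indep_family :: "('i \<Rightarrow> ('n, 'k::field) mpoly) \<Rightarrow> 'i set \<Rightarrow> bool" where
  "indep_family a S \<longleftrightarrow> (\<forall>c. (\<Sum>k\<in>S. scale (c k) (a k)) = 0 \<longrightarrow> (\<forall>k\<in>S. c k = 0))"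

lemma indep_familyD: "indep_family a S \<Longrightarrow> (\<Sum>k\<in>S. scale (c k) (a k)) = 0 \<Longrightarrow> k \<in> S \<Longrightarrow> c k = 0"
  by (auto simp: indep_family_def)

lemma indep_family_iff:
  assumes "finite S"
  shows "indep_family a S \<longleftrightarrow> inj_on a S \<and> mpoly.independent (a ` S)"
proof
  assume *: "indep_family a S"
  have inj: "inj_on a S"
  proof (rule inj_onI, rule ccontr)
    fix k l assume kl: "k \<in> S" "l \<in> S" "a k = a l" "k \<noteq> l"
    let ?c = "\<lambda>i. if i = k then 1 else if i = l then -1 else 0"
    have "(\<Sum>i\<in>S. scale (?c i) (a i)) = (\<Sum>i\<in>{k,l}. scale (?c i) (a i))"
      using kl assms by (intro sum.mono_neutral_right) auto
    also have "\<dots> = 0" using kl by simp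
    finally show False using indep_familyD[OF *, of ?c k] kl by simp
  qed
  moreover have "mpoly.independent (a ` S)"
  proof
    assume "mpoly.dependent (a ` S)"
    then obtain u v where u: "v \<in> a ` S" "u v \<noteq> 0" "(\<Sum>v\<in>a ` S. scale (u v) v) = 0"
      using assms by (subst (asm) mpoly.dependent_finite) auto
    then have "(\<Sum>k\<in>S. scale (u (a k)) (a k)) = 0" by (simp add: sum.reindex[OF inj])
    then show False using indep_familyD[OF *, of "u \<circ> a"] u by auto
  qed
  ultimately show "inj_on a S \<and> mpoly.independent (a ` S)" by simp
next
  assume *: "inj_on a S \<and> mpoly.independent (a ` S)"
  show "indep_family a S" unfolding indep_family_def
  proof (intro allI impI ballI)
    fix c k assume c: "(\<Sum>k\<in>S. scale (c k) (a k)) = 0" and "k \<in> S"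
    have "(\<Sum>v\<in>a ` S. scale (c (inv_into S a v)) v) = (\<Sum>k\<in>S. scale (c k) (a k))"
      using * by (subst sum.reindex) auto
    then have "c (inv_into S a (a k)) = 0"
      using * c \<open>k \<in> S\<close> assms
      by (intro mpoly.independentD[of "a ` S" "a ` S" "c \<circ> inv_into S a" "a k", simplified comp_def]) auto
    then show "c k = 0" using * \<open>k \<in> S\<close> by simp
  qed
qed

lemma indep_family_card_le:
  assumes "finite S" "indep_family a S" "finite T" "\<And>k. k \<in> S \<Longrightarrow> a k \<in> mpoly.span T"
  shows "card S \<le> card T"
proof -
  have "inj_on a S" "mpoly.independent (a ` S)" using assms indep_family_iff by blast+
  moreover have "card (a ` S) \<le> card T"
    using mpoly.independent_span_bound[of T "a ` S"] calculation assms by auto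
  ultimately show ?thesis by (simp add: card_image)
qed

lemma indep_family_card_le_dim:
  assumes "finite S" "indep_family a S" "finite T" "\<And>k. k \<in> S \<Longrightarrow> a k \<in> mpoly.span T"
  shows "card S \<le> dim (mpoly.span T)"
proof -
  obtain B where B: "B \<subseteq> mpoly.span T" "mpoly.independent B" "mpoly.span T \<subseteq> mpoly.span B"
    "card B = dim (mpoly.span T)"
    using mpoly.basis_exists by blast
  have "finite B" using mpoly.independent_span_bound[OF assms(3) B(2,1)] by simp
  then show ?thesis using indep_family_card_le[OF assms(1,2), of B] assms(4) B by auto
qed

lemma indep_family_dim:
  assumes "finite S" "indep_family a S"
  shows "dim (mpoly.span (a ` S)) = card S"
  using assms by (simp add: indep_family_iff mpoly.dim_span_eq_card_independent card_image del: mpoly.dim_span)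

text \<open>The hypothesis says that \<open>a k \<mapsto> b k\<close> extends to a linear map.\<close>

lemma dim_span_le_of_relations:
  fixes a b :: "'i \<Rightarrow> ('n, 'k::field) mpoly"
  assumes "finite K" and rel: "\<And>c. (\<Sum>k\<in>K. scale (c k) (a k)) = 0 \<Longrightarrow> (\<Sum>k\<in>K. scale (c k) (b k)) = 0"
  shows "dim (mpoly.span (b ` K)) \<le> dim (mpoly.span (a ` K))"
proof -
  obtain B where B: "B \<subseteq> b ` K" "mpoly.independent B" "b ` K \<subseteq> mpoly.span B"
    using mpoly.maximal_independent_subset by blast
  obtain S where S: "S \<subseteq> K" "inj_on b S" "B = b ` S"
    using B(1) by (auto simp: subset_image_inj)
  have finS: "finite S" using S assms finite_subset by blast
  have bS: "indep_family b S" using indep_family_iff[OF finS] S B by auto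
  have "indep_family a S" unfolding indep_family_def
  proof (intro allI impI)
    fix c assume c: "(\<Sum>k\<in>S. scale (c k) (a k)) = 0"
    let ?c = "\<lambda>k. if k \<in> S then c k else 0"
    have "(\<Sum>k\<in>K. scale (?c k) (f k)) = (\<Sum>k\<in>S. scale (c k) (f k))"
      for f :: "'i \<Rightarrow> ('n, 'k) mpoly"
      using S assms by (intro sum.mono_neutral_cong_right) auto
    then have "(\<Sum>k\<in>S. scale (c k) (b k)) = 0" using rel[of ?c] c by simp
    then show "\<forall>k\<in>S. c k = 0" using bS by (auto simp: indep_family_def)
  qed
  then have "card S \<le> dim (mpoly.span (a ` K))"
    using finS S(1) assms(1) by (intro indep_family_card_le_dim[of S a]) (auto intro: mpoly.span_base)
  moreover have "dim (mpoly.span (b ` K)) = card S"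
  proof -
    have "mpoly.span (b ` K) = mpoly.span B"
      using B by (simp add: mpoly.span_eq) (meson mpoly.span_superset order_trans)
    then show ?thesis using indep_family_dim[OF finS bS] S by simp
  qed
  ultimately show ?thesis by simp
qed

lemma indep_family_monom:
  assumes "finite (S :: 'n monomial set)"
  shows "indep_family (monom :: 'n monomial \<Rightarrow> ('n, 'k::field) mpoly) S"
  unfolding indep_family_def
proof (intro allI impI ballI)
  fix c :: "'n monomial \<Rightarrow> 'k" and k
  assume c: "(\<Sum>k\<in>S. scale (c k) (monom k)) = 0" and k: "k \<in> S"
  have "0 = Poly_Mapping.lookup (\<Sum>k\<in>S. scale (c k) (monom k)) k" using c by simp
  also have "\<dots> = (\<Sum>l\<in>S. if l = k then c l else 0)"
    unfolding lookup_sum by (intro sum.cong) (auto simp: lookup_monom)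
  also have "\<dots> = c k" using assms k by simp
  finally show "c k = 0" by simp
qed

section \<open>Leading monomials\<close>

definition lead :: "('n::linorder, 'k::zero) mpoly \<Rightarrow> 'n monomial" where
  "lead p = Max (keys p)"

lemma lead_in_keys: "p \<noteq> 0 \<Longrightarrow> lead p \<in> keys p"
  unfolding lead_def by (intro Max_in) auto

lemma le_lead: "u \<in> keys p \<Longrightarrow> u \<le> lead p"
  unfolding lead_def by (intro Max_ge) auto

lemma lead_monom_mult:
  fixes p :: "('n::linorder, 'k::field) mpoly"
  assumes "p \<noteq> 0"
  shows "lead (monom u * p) = u + lead p"
proof -
  have "mono ((+) u)" by (auto intro: monoI add_left_mono)
  then show ?thesis using mono_Max_commute[of "(+) u" "keys p"] assms
    by (simp add: lead_def keys_monom_mult)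
qed

definition restr :: "'n monomial set \<Rightarrow> ('n, 'k::zero) mpoly \<Rightarrow> ('n, 'k) mpoly" where
  "restr A p = Poly_Mapping.mapp (\<lambda>k c. if k \<in> A then c else 0) p"

lemma lookup_restr: "Poly_Mapping.lookup (restr A p) u = (if u \<in> A then Poly_Mapping.lookup p u else 0)"
  by (auto simp: restr_def lookup_mapp when_def in_keys_iff)

lemma keys_restr: "keys (restr A p) = keys p \<inter> A"
  by (auto simp: in_keys_iff lookup_restr split: if_splits)

lemma restr_sum: "restr A (sum f S) = (\<Sum>s\<in>S. restr A (f s) :: ('n, 'k::field) mpoly)"
  by (rule poly_mapping_eqI) (auto simp: lookup_restr lookup_sum)

lemma restr_scale: "restr A (scale c p) = scale c (restr A p :: ('n, 'k::field) mpoly)"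
  by (rule poly_mapping_eqI) (simp add: lookup_restr)

text \<open>Forgetting all coefficients except those at the leading monomials is injective on the span, since
  a nonzero element keeps at least its leading coefficient.\<close>

lemma leads_of_span:
  fixes a :: "'i \<Rightarrow> ('n::linorder, 'k::field) mpoly"
  assumes "finite S" "indep_family a S"
  shows "finite (lead ` (mpoly.span (a ` S) - {0}))"
    and "card S \<le> card (lead ` (mpoly.span (a ` S) - {0}))"
proof -
  let ?A = "lead ` (mpoly.span (a ` S) - {0})"
  let ?K = "\<Union>s\<in>S. keys (a s)"
  have "mpoly.span (a ` S) \<subseteq> {p. keys p \<subseteq> ?K}"
    by (intro mpoly.span_minimal subspace_keys) auto
  then have "?A \<subseteq> ?K" using lead_in_keys by blast
  then show fin: "finite ?A" using assms(1) finite_subset[of ?A ?K] by auto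
  have "indep_family (\<lambda>s. restr ?A (a s)) S" unfolding indep_family_def
  proof (intro allI impI)
    fix c assume c: "(\<Sum>s\<in>S. scale (c s) (restr ?A (a s))) = 0"
    let ?p = "\<Sum>s\<in>S. scale (c s) (a s)"
    have "?p \<in> mpoly.span (a ` S)"
      by (intro mpoly.span_sum mpoly.span_scale mpoly.span_base) auto
    have "restr ?A ?p = 0" using c by (simp add: restr_sum restr_scale)
    have "?p = 0"
    proof (rule ccontr)
      assume "?p \<noteq> 0"
      then have "lead ?p \<in> ?A" using \<open>?p \<in> _\<close> by blast
      then have "lead ?p \<in> keys (restr ?A ?p)" using lead_in_keys[OF \<open>?p \<noteq> 0\<close>] by (simp add: keys_restr)
      then show False using \<open>restr ?A ?p = 0\<close> by simp
    qed
    then show "\<forall>k\<in>S. c k = 0" using assms(2) by (auto simp: indep_family_def)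
  qed
  then have "card S \<le> card ((monom :: _ \<Rightarrow> ('n, 'k) mpoly) ` ?A)"
    using assms(1) fin
    by (intro indep_family_card_le[of S "\<lambda>s. restr ?A (a s)"]) (auto simp: span_monoms keys_restr)
  also have "\<dots> \<le> card ?A" using fin by (rule card_image_le)
  finally show "card S \<le> card ?A" .
qed

lemma indep_family_leads:
  fixes f :: "'n::linorder monomial \<Rightarrow> ('n, 'k::field) mpoly"
  assumes "finite A" "\<And>u. u \<in> A \<Longrightarrow> f u \<noteq> 0" "\<And>u. u \<in> A \<Longrightarrow> lead (f u) = u"
  shows "indep_family f A"
  unfolding indep_family_def
proof (intro allI impI, rule ccontr)
  fix c assume c: "(\<Sum>u\<in>A. scale (c u) (f u)) = 0" and ne: "\<not> (\<forall>k\<in>A. c k = 0)"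
  define m where "m = Max {u\<in>A. c u \<noteq> 0}"
  have "{u\<in>A. c u \<noteq> 0} \<noteq> {}" using ne by auto
  then have "m \<in> {u\<in>A. c u \<noteq> 0}" unfolding m_def using assms(1) by (intro Max_in) auto
  then have m: "m \<in> A" "c m \<noteq> 0" by auto
  have m_max: "u \<le> m" if "u \<in> A" "c u \<noteq> 0" for u
    unfolding m_def using that assms(1) by (intro Max_ge) auto
  have "0 = (\<Sum>u\<in>A. c u * Poly_Mapping.lookup (f u) m)"
    using arg_cong[OF c, of "\<lambda>p. Poly_Mapping.lookup p m"] by (simp add: lookup_sum)
  also have "\<dots> = (\<Sum>u\<in>{m}. c u * Poly_Mapping.lookup (f u) m)"
  proof (rule sum.mono_neutral_right[OF assms(1)])
    show "\<forall>u\<in>A - {m}. c u * Poly_Mapping.lookup (f u) m = 0"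
    proof
      fix u assume u: "u \<in> A - {m}"
      show "c u * Poly_Mapping.lookup (f u) m = 0"
      proof (cases "c u = 0")
        case False
        then have "lead (f u) < m" using m_max[of u] u assms(3) by auto
        then have "m \<notin> keys (f u)" using le_lead[of m "f u"] by auto
        then show ?thesis by (simp add: in_keys_iff)
      qed simp
    qed
  qed (use m in auto)
  finally have "Poly_Mapping.lookup (f m) m = 0" using m(2) by simp
  then show False using lead_in_keys[OF assms(2)[OF m(1)]] assms(3)[OF m(1)] by (simp add: in_keys_iff)
qed

section \<open>Forms and homogeneous components\<close>

lemma is_form_iff_keys: "is_form d p \<longleftrightarrow> keys p \<subseteq> mons UNIV d"
  by (auto simp: is_form_def mons_UNIV)

lemma is_form_zero [simp]: "is_form d 0"
  by (simp add: is_form_def)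

lemma is_form_add: "is_form d p \<Longrightarrow> is_form d q \<Longrightarrow> is_form d (p + q)"
  unfolding is_form_iff_keys using keys_add[of p q] by blast

lemma is_form_sum: "(\<And>s. s \<in> S \<Longrightarrow> is_form d (f s)) \<Longrightarrow> is_form d (sum f S)"
  by (induction S rule: infinite_finite_induct) (auto intro: is_form_add)

lemma is_form_mult: "is_form d p \<Longrightarrow> is_form e q \<Longrightarrow> is_form (d + e) (p * q)"
  unfolding is_form_def using keys_mult[of p q] by fastforce

lemma is_form_uminus: "is_form d p \<Longrightarrow> is_form d (- p :: ('n::finite, 'k::field) mpoly)"
  by (auto simp: is_form_def in_keys_iff)

lemma is_form_diff: "is_form d p \<Longrightarrow> is_form d q \<Longrightarrow> is_form d (p - q :: ('n::finite, 'k::field) mpoly)"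
  using is_form_add[of d p "- q"] is_form_uminus[of d q] by simp

lemma is_form_scale: "is_form d p \<Longrightarrow> is_form d (scale c p)"
  unfolding is_form_iff_keys using keys_scale[of c p] by blast

lemma is_form_monom: "is_form (mdeg u) (monom u :: ('n::finite, 'k::field) mpoly)"
  by (simp add: is_form_def)

lemma is_form_var: "is_form (Suc 0) (var i :: ('n::finite, 'k::field) mpoly)"
  by (simp add: is_form_def var_eq_monom)

lemma is_form_one: "is_form 0 (1 :: ('n::finite, 'k::field) mpoly)"
  using is_form_monom[of 0] by simp

lemma is_form_unique: "is_form d p \<Longrightarrow> is_form e p \<Longrightarrow> p \<noteq> 0 \<Longrightarrow> d = e"
  unfolding is_form_def using keys_eq_empty[of p] by fastforce

definition hcomp :: "nat \<Rightarrow> ('n::finite, 'k::zero) mpoly \<Rightarrow> ('n, 'k) mpoly" where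
  "hcomp d = restr (mons UNIV d)"

lemma lookup_hcomp: "Poly_Mapping.lookup (hcomp d p) u = (if mdeg u = d then Poly_Mapping.lookup p u else 0)"
  by (simp add: hcomp_def lookup_restr mons_UNIV)

lemma is_form_hcomp [simp]: "is_form d (hcomp d p)"
  by (simp add: is_form_iff_keys hcomp_def keys_restr)

lemma hcomp_form: "is_form d p \<Longrightarrow> hcomp e p = (if d = e then p else 0)"
  by (rule poly_mapping_eqI) (auto simp: lookup_hcomp is_form_def in_keys_iff)

lemma hcomp_sum: "hcomp d (sum f S) = (\<Sum>s\<in>S. hcomp d (f s) :: ('n::finite, 'k::field) mpoly)"
  by (simp add: hcomp_def restr_sum)

lemma hcomp_scale: "hcomp d (scale c p) = scale c (hcomp d p :: ('n::finite, 'k::field) mpoly)"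
  by (simp add: hcomp_def restr_scale)

lemma poly_bounded_degree: "\<exists>m. \<forall>u\<in>keys p. mdeg u \<le> m" for p :: "('n::finite, 'k::zero) mpoly"
  by (rule exI[of _ "Max (mdeg ` keys p)"]) auto

lemma hcomp_expand:
  fixes p :: "('n::finite, 'k::field) mpoly"
  assumes "\<And>u. u \<in> keys p \<Longrightarrow> mdeg u \<le> m"
  shows "p = (\<Sum>d\<le>m. hcomp d p)"
proof (rule poly_mapping_eqI)
  fix u
  have "(\<Sum>d\<le>m. Poly_Mapping.lookup (hcomp d p) u) = (if mdeg u \<le> m then Poly_Mapping.lookup p u else 0)"
    by (simp add: lookup_hcomp)
  then show "Poly_Mapping.lookup p u = Poly_Mapping.lookup (\<Sum>d\<le>m. hcomp d p) u"
    using assms[of u] by (auto simp: lookup_sum in_keys_iff)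
qed

lemma hcomp_mult_form:
  fixes p g :: "('n::finite, 'k::field) mpoly"
  assumes "is_form e g"
  shows "hcomp d (p * g) = (if e \<le> d then hcomp (d - e) p * g else 0)"
proof -
  obtain m where m: "\<And>u. u \<in> keys p \<Longrightarrow> mdeg u \<le> m" using poly_bounded_degree[of p] by blast
  let ?M = "m + d"
  have "p = (\<Sum>k\<le>?M. hcomp k p)" using m by (intro hcomp_expand) (simp add: trans_le_add1)
  then have "p * g = (\<Sum>k\<le>?M. hcomp k p * g)" by (metis sum_distrib_right)
  then have "hcomp d (p * g) = (\<Sum>k\<le>?M. hcomp d (hcomp k p * g))" by (simp add: hcomp_sum)
  also have "\<dots> = (\<Sum>k\<le>?M. if k + e = d then hcomp k p * g else 0)"
    using hcomp_form[OF is_form_mult[OF is_form_hcomp assms]] by (intro sum.cong) simp_all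
  also have "\<dots> = (\<Sum>k\<le>?M. if e \<le> d \<and> k = d - e then hcomp k p * g else 0)"
    by (intro sum.cong) auto
  also have "\<dots> = (if e \<le> d then hcomp (d - e) p * g else 0)"
    using trans_le_add2[OF diff_le_self, of d e m] by simp
  finally show ?thesis .
qed

lemma form_mult_in_span:
  fixes r g :: "('n::finite, 'k::field) mpoly"
  assumes "is_form e r"
  shows "r * g \<in> mpoly.span ((\<lambda>u. monom u * g) ` mons UNIV e)"
proof -
  have "r * g = (\<Sum>u\<in>keys r. scale (Poly_Mapping.lookup r u) (monom u * g))"
    by (subst poly_expand_monom[of r]) (simp add: sum_distrib_right scale_mult_left)
  also have "\<dots> \<in> mpoly.span ((\<lambda>u. monom u * g) ` mons UNIV e)"
    using assms by (intro mpoly.span_sum mpoly.span_scale mpoly.span_base) (auto simp: is_form_iff_keys)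
  finally show ?thesis .
qed

lemma subspace_forms: "mpoly.subspace {p :: ('n::finite, 'k::field) mpoly. is_form d p}"
  unfolding is_form_iff_keys by (rule subspace_keys)

lemma subspace_ideal: "mpoly.subspace (ideal B :: ('n, 'k::field) mpoly set)"
  by (rule mpoly.subspaceI)
    (auto simp: ring_module.span_zero ring_module.span_add scale_def ring_module.span_scale)

lemma ideal_mult_left: "p \<in> ideal B \<Longrightarrow> r * p \<in> ideal B" for p :: "'a::comm_ring_1"
  by (rule ring_module.span_scale)

section \<open>The graded pieces of an equigenerated ideal\<close>

lemma in_ideal_finite:
  fixes G :: "'a::comm_ring_1 set"
  assumes "finite G"
  shows "p \<in> ideal G \<longleftrightarrow> (\<exists>r. p = (\<Sum>g\<in>G. r g * g))"
  unfolding ring_module.span_finite[OF assms] by auto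

lemma hcomp_in_ideal:
  fixes p :: "('n::finite, 'k::field) mpoly"
  assumes "finite G" "\<And>g. g \<in> G \<Longrightarrow> is_form a g" "p \<in> ideal G"
  obtains r where "\<And>g. is_form (d - a) (r g)" "hcomp d p = (if a \<le> d then \<Sum>g\<in>G. r g * g else 0)"
proof -
  obtain r where r: "p = (\<Sum>g\<in>G. r g * g)" using assms in_ideal_finite by blast
  have "hcomp d p = (\<Sum>g\<in>G. if a \<le> d then hcomp (d - a) (r g) * g else 0)"
    unfolding r hcomp_sum using assms(2) by (intro sum.cong refl hcomp_mult_form)
  then show thesis using that[of "\<lambda>g. hcomp (d - a) (r g)"] by simp
qed

lemma graded_part_low:
  fixes G :: "('n::finite, 'k::field) mpoly set"
  assumes "finite G" "\<And>g. g \<in> G \<Longrightarrow> is_form a g" "d < a"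
  shows "graded_part (ideal G) d = {0}"
proof -
  have "p = 0" if "p \<in> ideal G" "is_form d p" for p
    using hcomp_in_ideal[OF assms(1,2) that(1), of d] assms(3) hcomp_form[OF that(2), of d] by auto
  then show ?thesis by (auto simp: graded_part_def ring_module.span_zero)
qed

lemma graded_part_ideal:
  fixes G :: "('n::finite, 'k::field) mpoly set"
  assumes "finite G" "\<And>g. g \<in> G \<Longrightarrow> is_form a g"
  shows "graded_part (ideal G) (a + e) = mpoly.span ((\<lambda>(u, g). monom u * g) ` (mons UNIV e \<times> G))"
    (is "_ = mpoly.span ?B")
proof
  show "graded_part (ideal G) (a + e) \<subseteq> mpoly.span ?B"
  proof
    fix p assume p: "p \<in> graded_part (ideal G) (a + e)"
    then obtain r where r: "\<And>g. is_form e (r g)" "hcomp (a + e) p = (\<Sum>g\<in>G. r g * g)"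
      using hcomp_in_ideal[OF assms, of p "a + e"] by (auto simp: graded_part_def)
    have "p = (\<Sum>g\<in>G. r g * g)" using p r(2) hcomp_form[of "a + e" p "a + e"] by (simp add: graded_part_def)
    also have "\<dots> \<in> mpoly.span ?B"
    proof (rule mpoly.span_sum)
      fix g assume "g \<in> G"
      then have "(\<lambda>u. monom u * g) ` mons UNIV e \<subseteq> ?B" by auto
      then show "r g * g \<in> mpoly.span ?B"
        using form_mult_in_span[OF r(1)[of g], of g] mpoly.span_mono by blast
    qed
    finally show "p \<in> mpoly.span ?B" .
  qed
  have "mpoly.subspace (graded_part (ideal G) (a + e))"
  proof -
    have "graded_part (ideal G) (a + e) = ideal G \<inter> {p. is_form (a + e) p}"
      by (auto simp: graded_part_def)
    then show ?thesis using mpoly.subspace_inter[OF subspace_ideal subspace_forms] by metis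
  qed
  moreover have "?B \<subseteq> graded_part (ideal G) (a + e)"
  proof clarify
    fix u :: "'n monomial" and g :: "('n, 'k) mpoly"
    assume "u \<in> mons UNIV e" "g \<in> G"
    then have "is_form (e + a) (monom u * g)"
      using is_form_mult[OF is_form_monom[of u] assms(2)[of g]] by (simp add: mons_UNIV)
    then show "monom u * g \<in> graded_part (ideal G) (a + e)"
      using \<open>g \<in> G\<close> by (simp add: graded_part_def ideal_mult_left ring_module.span_base add.commute)
  qed
  ultimately show "mpoly.span ?B \<subseteq> graded_part (ideal G) (a + e)"
    by (rule mpoly.span_minimal[rotated])
qed

lemma mons_0: "mons UNIV 0 = {0}"
proof -
  have "u = 0" if "mdeg u = 0" for u :: "'n::finite monomial"
    using that by (intro poly_mapping_eqI) (simp add: mdeg_def)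
  then show ?thesis by (auto simp: mons_UNIV)
qed

lemma mons_Suc_0: "mons UNIV (Suc 0) = range (ex :: 'n::finite \<Rightarrow> _)"
proof -
  have "u \<in> range ex" if u: "mdeg u = Suc 0" for u :: "'n monomial"
  proof -
    have "\<exists>i. ev u i > 0"
    proof (rule ccontr)
      assume "\<not> (\<exists>i. ev u i > 0)"
      then show False using u by (simp add: mdeg_def)
    qed
    then obtain i where i: "ev u i > 0" by blast
    have "u - ex i \<in> mons UNIV 0" using mdeg_diff_ex[OF i] u by (simp add: mons_UNIV)
    then have "u - ex i = 0" by (simp add: mons_0)
    then have "u = ex i" using monomial_split_off[OF i] by simp
    then show ?thesis by simp
  qed
  then show ?thesis by (auto simp: mons_UNIV)
qed

lemma hilbert_function_low:
  fixes G :: "('n::finite, 'k::field) mpoly set"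
  assumes "finite G" "\<And>g. g \<in> G \<Longrightarrow> is_form a g" "d < a"
  shows "hilbert_function (ideal G) d = 0"
proof -
  have "graded_part (ideal G) d = {0}" using assms by (rule graded_part_low)
  then show ?thesis using mpoly.dim_le_card[of "{0}" "{}"] by (simp add: hilbert_function_def)
qed

lemma hilbert_function_initial:
  fixes G :: "('n::finite, 'k::field) mpoly set"
  assumes "finite G" "\<And>g. g \<in> G \<Longrightarrow> is_form a g" "indep_family (\<lambda>g. g) G"
  shows "hilbert_function (ideal G) a = card G"
proof -
  have "graded_part (ideal G) a = mpoly.span G"
  proof -
    have "(\<lambda>(u, g). monom u * g) ` (mons UNIV 0 \<times> G) = G" by (force simp: mons_0)
    then show ?thesis using graded_part_ideal[OF assms(1,2), of 0] by simp
  qed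
  then show ?thesis
    using indep_family_dim[OF assms(1,3)] by (simp add: hilbert_function_def)
qed

lemma hilbert_function_next:
  fixes G :: "('n::finite, 'k::field) mpoly set"
  assumes "finite G" "\<And>g. g \<in> G \<Longrightarrow> is_form a g"
  shows "hilbert_function (ideal G) (Suc a) = dim (mpoly.span ((\<lambda>(i, g). var i * g) ` (UNIV \<times> G)))"
proof -
  have "(\<lambda>(u, g). monom u * g) ` (mons UNIV (Suc 0) \<times> G) = (\<lambda>(i, g). var i * g) ` (UNIV \<times> G)"
    by (force simp: mons_Suc_0 var_eq_monom)
  then show ?thesis
    using graded_part_ideal[OF assms, of "Suc 0"] by (simp add: hilbert_function_def del: mpoly.dim_span)
qed

section \<open>Monomial ideals\<close>

definition multiples :: "'n monomial set \<Rightarrow> 'n monomial set" where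
  "multiples M = {m + w | m w. m \<in> M}"

lemma ideal_monoms: "ideal (monom ` M) = {p :: ('n, 'k::field) mpoly. keys p \<subseteq> multiples M}"
proof
  show "ideal (monom ` M) \<subseteq> {p :: ('n, 'k) mpoly. keys p \<subseteq> multiples M}"
  proof (rule ring_module.span_minimal)
    show "monom ` M \<subseteq> {p :: ('n, 'k) mpoly. keys p \<subseteq> multiples M}"
      by (auto simp: multiples_def) (metis add.right_neutral)
    show "ring_module.subspace {p :: ('n, 'k) mpoly. keys p \<subseteq> multiples M}"
    proof (rule ring_module.subspaceI)
      fix x y c :: "('n, 'k) mpoly"
      assume x: "x \<in> {p. keys p \<subseteq> multiples M}"
      show "c * x \<in> {p. keys p \<subseteq> multiples M}"
      proof clarify
        fix u assume "u \<in> keys (c * x)"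
        then obtain v w where "u = v + w" "w \<in> keys x" using keys_mult[of c x] by blast
        moreover obtain m w' where "w = m + w'" "m \<in> M"
          using x \<open>w \<in> keys x\<close> by (auto simp: multiples_def)
        ultimately have "u = m + (v + w')" "m \<in> M" by (simp_all add: ac_simps)
        then show "u \<in> multiples M" by (auto simp: multiples_def)
      qed
      assume "y \<in> {p. keys p \<subseteq> multiples M}"
      then show "x + y \<in> {p. keys p \<subseteq> multiples M}" using x keys_add[of x y] by auto
    qed simp
  qed
  show "{p :: ('n, 'k) mpoly. keys p \<subseteq> multiples M} \<subseteq> ideal (monom ` M)"
  proof
    fix p :: "('n, 'k) mpoly" assume p: "p \<in> {p. keys p \<subseteq> multiples M}"
    have "scale (Poly_Mapping.lookup p u) (monom u) \<in> ideal (monom ` M)" if "u \<in> keys p" for u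
    proof -
      have "u \<in> multiples M" using that p by auto
      then obtain m w where m: "u = m + w" "m \<in> M" by (auto simp: multiples_def)
      have "monom u = monom w * (monom m :: ('n, 'k) mpoly)" by (simp add: m(1) monom_mult add.commute)
      then have "(monom u :: ('n, 'k) mpoly) \<in> ideal (monom ` M)"
        using m(2) by (simp add: ideal_mult_left ring_module.span_base)
      then show ?thesis by (simp add: scale_def ideal_mult_left)
    qed
    then have "(\<Sum>u\<in>keys p. scale (Poly_Mapping.lookup p u) (monom u)) \<in> ideal (monom ` M)"
      by (rule ring_module.span_sum)
    then show "p \<in> ideal (monom ` M)" using poly_expand_monom[of p] by simp
  qed
qed

lemma keys_set_plus:
  "{p :: ('n, 'k::field) mpoly. keys p \<subseteq> A} + {p. keys p \<subseteq> B} = {p. keys p \<subseteq> A \<union> B}"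
proof (intro equalityI subsetI)
  fix p :: "('n, 'k) mpoly" assume "p \<in> {p. keys p \<subseteq> A} + {p. keys p \<subseteq> B}"
  then obtain q r where "p = q + r" "keys q \<subseteq> A" "keys r \<subseteq> B" by (auto elim!: set_plus_elim)
  then show "p \<in> {p. keys p \<subseteq> A \<union> B}" using keys_add[of q r] by auto
next
  fix p :: "('n, 'k) mpoly" assume p: "p \<in> {p. keys p \<subseteq> A \<union> B}"
  have "p = restr A p + restr (- A) p"
    by (rule poly_mapping_eqI) (simp add: lookup_add lookup_restr)
  moreover have "keys (restr A p) \<subseteq> A" "keys (restr (- A) p) \<subseteq> B"
    using p by (auto simp: keys_restr)
  ultimately show "p \<in> {p. keys p \<subseteq> A} + {p. keys p \<subseteq> B}"
    by (metis mem_Collect_eq set_plus_intro)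
qed

lemma hilbert_function_keys:
  "hilbert_function {p :: ('n::finite, 'k::field) mpoly. keys p \<subseteq> A} d = card (A \<inter> mons UNIV d)"
proof -
  have "graded_part {p :: ('n, 'k) mpoly. keys p \<subseteq> A} d = mpoly.span (monom ` (A \<inter> mons UNIV d))"
    unfolding span_monoms by (auto simp: graded_part_def is_form_iff_keys)
  moreover have "dim (mpoly.span (monom ` (A \<inter> mons UNIV d)) :: ('n, 'k) mpoly set) = card (A \<inter> mons UNIV d)"
    by (intro indep_family_dim indep_family_monom) auto
  ultimately show ?thesis by (simp add: hilbert_function_def del: mpoly.dim_span)
qed

section \<open>Counting monomials\<close>

lemma card_bounded_monomials:
  "card {u :: 'n::finite monomial. \<forall>i. ev u i \<le> m} \<le> (m + 1) ^ CARD('n)"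
proof -
  have "card {u :: 'n monomial. \<forall>i. ev u i \<le> m} \<le> card (Pi\<^sub>E (UNIV :: 'n set) (\<lambda>_. {..m}))"
  proof (rule card_inj_on_le)
    show "inj_on ev {u :: 'n monomial. \<forall>i. ev u i \<le> m}"
      by (rule inj_onI, rule poly_mapping_eqI) metis
  qed (auto simp: PiE_iff intro!: finite_PiE)
  also have "\<dots> = (m + 1) ^ CARD('n)" by (simp add: card_PiE)
  finally show ?thesis .
qed

text \<open>All exponents except one can be chosen freely up to \<open>s\<close>; the last one makes up for the degree.\<close>

lemma card_mons_ge:
  assumes "CARD('n::finite) * s \<le> m"
  shows "(s + 1) ^ (CARD('n) - 1) \<le> card (mons (UNIV :: 'n set) m)"
proof -
  define z :: 'n where "z = (SOME z. True)"
  let ?P = "Pi\<^sub>E (UNIV - {z}) (\<lambda>_. {..s})"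
  define F where "F \<gamma> = (\<Sum>i\<in>UNIV - {z}. Poly_Mapping.single i (\<gamma> i))
    + Poly_Mapping.single z (m - (\<Sum>i\<in>UNIV - {z}. \<gamma> i))" for \<gamma> :: "'n \<Rightarrow> nat"
  have ev_F: "ev (F \<gamma>) i = \<gamma> i" if "i \<noteq> z" for \<gamma> i
  proof -
    have "(\<Sum>k\<in>UNIV - {z}. ev (Poly_Mapping.single k (\<gamma> k)) i) = (\<Sum>k\<in>{i}. \<gamma> k)"
      using that by (intro sum.mono_neutral_cong_right) (auto simp: lookup_single when_def)
    then show ?thesis using that by (simp add: F_def lookup_add lookup_sum lookup_single when_def)
  qed
  have "card ?P \<le> card (mons (UNIV :: 'n set) m)"
  proof (rule card_inj_on_le)
    show "inj_on F ?P"
    proof (rule inj_onI)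
      fix \<gamma> \<gamma>' assume "\<gamma> \<in> ?P" "\<gamma>' \<in> ?P" "F \<gamma> = F \<gamma>'"
      then show "\<gamma> = \<gamma>'" using ev_F[of _ \<gamma>] ev_F[of _ \<gamma>'] by (intro PiE_ext) auto
    qed
    show "F ` ?P \<subseteq> mons UNIV m"
    proof clarify
      fix \<gamma> assume \<gamma>: "\<gamma> \<in> ?P"
      have "(\<Sum>i\<in>UNIV - {z}. \<gamma> i) \<le> (\<Sum>i\<in>UNIV - {z}. s)" using \<gamma> by (intro sum_mono) auto
      also have "\<dots> \<le> CARD('n) * s" by (simp add: card_Diff_singleton)
      finally have "(\<Sum>i\<in>UNIV - {z}. \<gamma> i) \<le> m" using assms by simp
      then show "F \<gamma> \<in> mons UNIV m" by (simp add: F_def mons_UNIV mdeg_sum)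
    qed
  qed simp
  then show ?thesis by (simp add: card_PiE card_Diff_singleton)
qed

section \<open>Ideals containing a long regular sequence\<close>

definition indep_mod :: "('n, 'k::field) mpoly set \<Rightarrow> ('i \<Rightarrow> ('n, 'k) mpoly) \<Rightarrow> 'i set \<Rightarrow> bool" where
  "indep_mod Q a S \<longleftrightarrow> (\<forall>c. (\<Sum>k\<in>S. scale (c k) (a k)) \<in> Q \<longrightarrow> (\<forall>k\<in>S. c k = 0))"

text \<open>Modulo \<open>f\<close> only the term without \<open>f\<close> survives, and its coefficients vanish by
  independence; then one factor \<open>f\<close> can be cancelled and the argument repeated.\<close>

lemma indep_mod_powers:
  fixes f :: "('n, 'k::field) mpoly"
  assumes nzd: "\<And>g. f * g \<in> ideal B \<Longrightarrow> g \<in> ideal B"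
    and ind: "indep_mod (ideal (insert f B)) a S"
  shows "(\<Sum>k<m. f ^ k * (\<Sum>s\<in>S. scale (c k s) (a s))) \<in> ideal B \<Longrightarrow> \<forall>k<m. \<forall>s\<in>S. c k s = 0"
proof (induction m arbitrary: c)
  case (Suc m)
  define w where "w = (\<Sum>s\<in>S. scale (c 0 s) (a s))"
  define q where "q = (\<Sum>k<m. f ^ k * (\<Sum>s\<in>S. scale (c (Suc k) s) (a s)))"
  have "(\<Sum>k<Suc m. f ^ k * (\<Sum>s\<in>S. scale (c k s) (a s))) = w + f * q"
    unfolding w_def q_def sum.lessThan_Suc_shift sum_distrib_left[of f] power_Suc mult.assoc power_0 mult_1_left ..
  then have wq: "w + f * q \<in> ideal B" using Suc.prems by simp
  have "f * q \<in> ideal (insert f B)"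
    using ideal_mult_left[OF ring_module.span_base[of f "insert f B"], of q] by (simp add: mult.commute)
  moreover have "w + f * q \<in> ideal (insert f B)"
    using wq ring_module.span_mono[of B "insert f B"] by blast
  ultimately have "w \<in> ideal (insert f B)"
    using ring_module.span_diff[of "w + f * q" _ "f * q"] by simp
  then have c0: "\<forall>s\<in>S. c 0 s = 0" using ind by (simp add: indep_mod_def w_def)
  then have "w = 0" by (simp add: w_def)
  then have "q \<in> ideal B" using wq nzd by simp
  then have "\<forall>k<m. \<forall>s\<in>S. c (Suc k) s = 0" using Suc.IH[of "\<lambda>k. c (Suc k)"] by (simp add: q_def)
  then show ?case using c0 by (auto simp: less_Suc_eq_0_disj)
qed simp

text \<open>The catch-all equation only serves for two empty lists, since both lists will have the same length.\<close>

fun power_product :: "'a::comm_monoid_mult list \<Rightarrow> nat list \<Rightarrow> 'a" where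
  "power_product (f # fs) (k # ks) = f ^ k * power_product fs ks"
| "power_product _ _ = 1"

text \<open>Applying \<open>indep_mod_powers\<close> to the members of a regular sequence, from the last one backwards: a
  family independent modulo the whole sequence stays independent modulo an initial part \<open>pre\<close> when it is
  multiplied by all the power products of the remaining members.\<close>

lemma indep_mod_power_products:
  fixes fs :: "('n, 'k::field) mpoly list"
  assumes "\<And>i g. i < length (pre @ fs) \<Longrightarrow> (pre @ fs) ! i * g \<in> ideal (set (take i (pre @ fs)))
      \<Longrightarrow> g \<in> ideal (set (take i (pre @ fs)))"
    and "indep_mod (ideal (set (pre @ fs))) a S" "finite S"
  shows "indep_mod (ideal (set pre)) (\<lambda>(ks, s). power_product fs ks * a s)
    ({ks. set ks \<subseteq> {..t} \<and> length ks = length fs} \<times> S)"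
  using assms
proof (induction fs arbitrary: pre)
  case Nil
  have "{ks :: nat list. set ks \<subseteq> {..t} \<and> length ks = length ([] :: ('n, 'k) mpoly list)} = {[]}" by auto
  moreover have "indep_mod Q (\<lambda>(ks, s). power_product [] ks * a s) ({[] :: nat list} \<times> S)"
    if "indep_mod Q a S" for Q
    unfolding indep_mod_def
  proof (intro allI impI)
    fix c assume "(\<Sum>x\<in>{[] :: nat list} \<times> S. scale (c x) (case x of (ks, s) \<Rightarrow> power_product [] ks * a s)) \<in> Q"
    moreover have "{[]} \<times> S = (\<lambda>s. ([] :: nat list, s)) ` S" by auto
    ultimately have "(\<Sum>s\<in>S. scale (c ([], s)) (a s)) \<in> Q"
      by (simp add: sum.reindex inj_on_def)
    then show "\<forall>x\<in>{[]} \<times> S. c x = 0" using that by (auto simp: indep_mod_def)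
  qed
  ultimately show ?case using Nil by simp
next
  case (Cons f fs)
  let ?L = "\<lambda>n. {ks. set ks \<subseteq> {..t} \<and> length ks = n}"
  let ?P = "?L (length fs) \<times> S"
  have finP: "finite ?P" using \<open>finite S\<close> by (simp add: finite_lists_length_eq)
  have IH: "indep_mod (ideal (set (pre @ [f]))) (\<lambda>(ks, s). power_product fs ks * a s) ?P"
    by (rule Cons.IH) (use Cons.prems in simp_all)
  have nzd: "g \<in> ideal (set pre)" if "f * g \<in> ideal (set pre)" for g
    using Cons.prems(1)[of "length pre" g] that by simp
  show ?case unfolding indep_mod_def
  proof (intro allI impI)
    fix c
    assume c: "(\<Sum>x\<in>?L (length (f # fs)) \<times> S. scale (c x) (case x of (ks, s) \<Rightarrow> power_product (f # fs) ks * a s))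
      \<in> ideal (set pre)"
    let ?h = "\<lambda>(k, ks, s). (k # ks, s)"
    have img: "?L (length (f # fs)) \<times> S = ?h ` ({..<Suc t} \<times> ?P)"
    proof (intro equalityI subsetI)
      fix x assume "x \<in> ?L (length (f # fs)) \<times> S"
      then obtain k ks s where "x = (k # ks, s)" "k \<le> t" "set ks \<subseteq> {..t}" "length ks = length fs" "s \<in> S"
        by (cases x; cases "fst x") auto
      then show "x \<in> ?h ` ({..<Suc t} \<times> ?P)" by (intro image_eqI[of _ _ "(k, ks, s)"]) auto
    qed auto
    have "inj_on ?h ({..<Suc t} \<times> ?P)" by (auto simp: inj_on_def)
    then have "(\<Sum>x\<in>?L (length (f # fs)) \<times> S. scale (c x) (case x of (ks, s) \<Rightarrow> power_product (f # fs) ks * a s))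
      = (\<Sum>(k, ks, s)\<in>{..<Suc t} \<times> ?P. scale (c (k # ks, s)) (f ^ k * (power_product fs ks * a s)))"
      unfolding img by (subst sum.reindex) (auto intro!: sum.cong simp only: o_def prod.case power_product.simps mult.assoc)
    also have "\<dots> = (\<Sum>k<Suc t. \<Sum>(ks, s)\<in>?P. scale (c (k # ks, s)) (f ^ k * (power_product fs ks * a s)))"
      by (subst sum.cartesian_product[symmetric]) (simp add: case_prod_unfold)
    also have "\<dots> = (\<Sum>k<Suc t. f ^ k * (\<Sum>x\<in>?P. scale (c (k # fst x, snd x)) (case x of (ks, s) \<Rightarrow> power_product fs ks * a s)))"
      by (simp add: sum_distrib_left scale_mult_right case_prod_unfold del: sum.lessThan_Suc)
    finally have "(\<Sum>k<Suc t. f ^ k * (\<Sum>x\<in>?P. scale (c (k # fst x, snd x))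
        (case x of (ks, s) \<Rightarrow> power_product fs ks * a s))) \<in> ideal (set pre)"
      using c by (simp only:)
    moreover have "indep_mod (ideal (insert f (set pre))) (\<lambda>(ks, s). power_product fs ks * a s) ?P"
      using IH by simp
    ultimately have "\<forall>k<Suc t. \<forall>x\<in>?P. c (k # fst x, snd x) = 0"
      using nzd by (intro indep_mod_powers[where c = "\<lambda>k x. c (k # fst x, snd x)"])
    then show "\<forall>x\<in>?L (length (f # fs)) \<times> S. c x = 0" unfolding img by auto
  qed
qed

definition exps_le :: "nat \<Rightarrow> ('n, 'k::zero) mpoly \<Rightarrow> bool" where
  "exps_le m p \<longleftrightarrow> (\<forall>u\<in>keys p. \<forall>i. ev u i \<le> m)"

lemma exps_le_mult: "exps_le m p \<Longrightarrow> exps_le l q \<Longrightarrow> exps_le (m + l) (p * q :: ('n, 'k::field) mpoly)"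
  unfolding exps_le_def
proof (intro ballI allI)
  fix u i assume "\<forall>u\<in>keys p. \<forall>i. ev u i \<le> m" "\<forall>u\<in>keys q. \<forall>i. ev u i \<le> l" "u \<in> keys (p * q)"
  moreover obtain v w where "u = v + w" "v \<in> keys p" "w \<in> keys q"
    using keys_mult[of p q] \<open>u \<in> keys (p * q)\<close> by blast
  ultimately show "ev u i \<le> m + l" by (simp add: lookup_add add_mono)
qed

lemma exps_le_mono: "exps_le m p \<Longrightarrow> m \<le> l \<Longrightarrow> exps_le l p"
  unfolding exps_le_def using order_trans by blast

lemma exps_le_power: "exps_le m p \<Longrightarrow> exps_le (k * m) (p ^ k :: ('n, 'k::field) mpoly)"
proof (induction k)
  case (Suc k)
  then show ?case using exps_le_mult[of m p "k * m" "p ^ k"] by simp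
qed (simp add: exps_le_def)

lemma exps_le_power_product:
  fixes fs :: "('n, 'k::field) mpoly list"
  assumes "\<And>f. f \<in> set fs \<Longrightarrow> exps_le e f" "set ks \<subseteq> {..t}"
  shows "exps_le (length fs * (t * e)) (power_product fs ks)"
  using assms
proof (induction fs ks rule: power_product.induct)
  case (1 f fs k ks)
  have "exps_le (t * e) (f ^ k)"
    by (rule exps_le_mono[OF exps_le_power[of e]]) (use 1 in auto)
  then show ?case using exps_le_mult[of "t * e" "f ^ k" "length fs * (t * e)" "power_product fs ks"] 1 by simp
qed (auto simp: exps_le_def)

lemma exps_le_exists:
  fixes a :: "'i \<Rightarrow> ('n::finite, 'k::zero) mpoly"
  assumes "finite S"
  shows "\<exists>m. \<forall>s\<in>S. exps_le m (a s)"
proof -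
  have fin: "finite (\<Union>s\<in>S. \<Union>u\<in>keys (a s). range (ev u))" using assms by auto
  have "ev u i \<le> Max (\<Union>s\<in>S. \<Union>u\<in>keys (a s). range (ev u))" if "s \<in> S" "u \<in> keys (a s)" for s u i
    using fin that by (intro Max_ge) auto
  then show ?thesis by (auto simp: exps_le_def)
qed

text \<open>By \<open>indep_mod_power_products\<close> there is an independent family of \<open>card S * (t + 1) ^ n\<close> polynomials, whose
  exponents are bounded by a linear function of \<open>t\<close>. There are only \<open>O (t ^ n)\<close> monomials with such
  exponents. The choice \<open>t = m\<close>, the bound for the exponents of the given family, makes the
  resulting bound on \<open>card S\<close> independent of that family.\<close>

lemma indep_mod_regular_sequence_bound:
  fixes fs :: "('n::finite, 'k::field) mpoly list"
  assumes "regular_sequence fs" "length fs = CARD('n)"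
  shows "\<exists>B. \<forall>(a :: 'i \<Rightarrow> ('n, 'k) mpoly) S. finite S \<longrightarrow> indep_mod (ideal (set fs)) a S \<longrightarrow> card S \<le> B"
proof -
  let ?n = "CARD('n)"
  obtain e where e: "\<And>f. f \<in> set fs \<Longrightarrow> exps_le e f" using exps_le_exists[of "set fs" "\<lambda>f. f"] by auto
  have "card S \<le> (?n * e + 1) ^ ?n" if S: "finite S" "indep_mod (ideal (set fs)) a S"
    for a :: "'i \<Rightarrow> ('n, 'k) mpoly" and S
  proof -
    obtain m where m: "\<And>s. s \<in> S \<Longrightarrow> exps_le m (a s)" using exps_le_exists[OF S(1), of a] by auto
    let ?L = "{ks. set ks \<subseteq> {..m} \<and> length ks = length fs}"
    let ?b = "\<lambda>(ks, s). power_product fs ks * a s"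
    let ?M = "?n * (m * e) + m"
    have "indep_mod (ideal (set [])) ?b (?L \<times> S)"
      using assms(1) S by (intro indep_mod_power_products) (auto simp: regular_sequence_def)
    then have ind: "indep_family ?b (?L \<times> S)" by (simp add: indep_mod_def indep_family_def)
    have finL: "finite ?L" by (simp add: finite_lists_length_eq)
    have "card (?L \<times> S) \<le> card ((monom :: _ \<Rightarrow> ('n, 'k) mpoly) ` {u. \<forall>i. ev u i \<le> ?M})"
    proof (rule indep_family_card_le[OF _ ind])
      fix x assume "x \<in> ?L \<times> S"
      then obtain ks s where x: "x = (ks, s)" "set ks \<subseteq> {..m}" "s \<in> S" by auto
      have "exps_le (length fs * (m * e)) (power_product fs ks)"
        by (rule exps_le_power_product[OF e x(2)])
      then have "exps_le ?M (?b x)" using exps_le_mult[OF _ m[OF x(3)]] assms(2) x(1) by simp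
      then show "?b x \<in> mpoly.span (monom ` {u. \<forall>i. ev u i \<le> ?M})"
        by (auto simp: span_monoms exps_le_def)
    qed (use finL S finite_bounded_monomials in auto)
    also have "\<dots> \<le> card {u :: 'n monomial. \<forall>i. ev u i \<le> ?M}"
      by (rule card_image_le[OF finite_bounded_monomials])
    also have "\<dots> \<le> (?M + 1) ^ ?n" by (rule card_bounded_monomials)
    also have "\<dots> \<le> ((m + 1) * (?n * e + 1)) ^ ?n"
      by (intro power_mono) (auto simp: algebra_simps)
    finally have "card (?L \<times> S) \<le> ((m + 1) * (?n * e + 1)) ^ ?n" .
    moreover have "card ?L = (m + 1) ^ ?n" by (simp add: card_lists_length_eq assms(2))
    ultimately have "(m + 1) ^ ?n * card S \<le> (m + 1) ^ ?n * (?n * e + 1) ^ ?n"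
      by (simp only: card_cartesian_product power_mult_distrib)
    then show ?thesis by (subst (asm) nat_mult_le_cancel1) simp_all
  qed
  then show ?thesis by blast
qed

lemma hcomp_closed_ideal:
  fixes G :: "('n::finite, 'k::field) mpoly set"
  assumes "finite G" "\<And>g. g \<in> G \<Longrightarrow> is_form a g" "p \<in> ideal G"
  shows "hcomp d p \<in> ideal G"
proof -
  obtain r where "hcomp d p = (if a \<le> d then \<Sum>g\<in>G. r g * g else 0)"
    by (rule hcomp_in_ideal[OF assms, where d = d]) (assumption | rule that)+
  moreover have "(\<Sum>g\<in>G. r g * g) \<in> ideal G"
    by (intro ring_module.span_sum ideal_mult_left ring_module.span_base)
  ultimately show ?thesis using ring_module.span_zero[of G] by simp
qed

text \<open>Choose a monomial outside the ideal in each degree in which there is one. As the ideal is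
  homogeneous, these monomials are independent modulo it, so there are only finitely many of them.\<close>

lemma forms_in_ideal_of_regular_sequence:
  fixes G :: "('n::finite, 'k::field) mpoly set"
  assumes G: "finite G" "\<And>g. g \<in> G \<Longrightarrow> is_form a g"
    and fs: "regular_sequence fs" "length fs = CARD('n)" "set fs \<subseteq> ideal G"
  obtains c where "\<And>d p. d \<ge> c \<Longrightarrow> is_form d p \<Longrightarrow> p \<in> ideal G"
proof -
  define bad where "bad = {d. \<exists>u\<in>mons UNIV d. (monom u :: ('n, 'k) mpoly) \<notin> ideal G}"
  have "\<forall>d\<in>bad. \<exists>u. mdeg u = d \<and> (monom u :: ('n, 'k) mpoly) \<notin> ideal G"
    by (auto simp: bad_def mons_UNIV)
  from bchoice[OF this] obtain u where u: "\<And>d. d \<in> bad \<Longrightarrow> mdeg (u d) = d"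
    "\<And>d. d \<in> bad \<Longrightarrow> (monom (u d) :: ('n, 'k) mpoly) \<notin> ideal G" by blast
  have sub: "ideal (set fs) \<subseteq> ideal G"
    by (rule ring_module.span_minimal[OF fs(3) ring_module.subspace_span])
  obtain B where B: "\<And>S. finite S \<Longrightarrow> indep_mod (ideal (set fs)) (\<lambda>d. monom (u d)) S \<Longrightarrow> card S \<le> B"
    using indep_mod_regular_sequence_bound[OF fs(1,2)] by blast
  have "card S \<le> B" if S: "finite S" "S \<subseteq> bad" for S
  proof (rule B[OF S(1)], unfold indep_mod_def, intro allI impI ballI, rule ccontr)
    fix c d assume c: "(\<Sum>d\<in>S. scale (c d) (monom (u d))) \<in> ideal (set fs)" and d: "d \<in> S" "c d \<noteq> 0"
    have mu: "mdeg (u d') = d'" if "d' \<in> S" for d' using u(1) S(2) that by blast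
    have "hcomp d (\<Sum>d\<in>S. scale (c d) (monom (u d))) = (\<Sum>d'\<in>S. if d' = d then scale (c d) (monom (u d)) else 0)"
      unfolding hcomp_sum hcomp_scale
      by (intro sum.cong refl) (simp add: hcomp_form[OF is_form_monom] mu)
    also have "\<dots> = scale (c d) (monom (u d))" using d S by simp
    finally have "scale (c d) (monom (u d)) \<in> ideal G"
      using hcomp_closed_ideal[OF G] c sub by (metis subsetD)
    then have "scale (inverse (c d)) (scale (c d) (monom (u d))) \<in> ideal G"
      by (simp add: scale_def ideal_mult_left)
    then show False using u(2)[of d] d S by auto
  qed
  then have "finite bad" using finite_if_finite_subsets_card_bdd[of bad B] by auto
  then obtain c where c: "\<And>d. d \<in> bad \<Longrightarrow> d < c" using finite_nat_set_iff_bounded by auto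
  have "p \<in> ideal G" if "d \<ge> c" "is_form d p" for d p
  proof -
    have "d \<notin> bad" using c that by (meson not_less)
    then have "(\<Sum>v\<in>keys p. scale (Poly_Mapping.lookup p v) (monom v)) \<in> ideal G"
      using that(2) by (intro mpoly.subspace_sum[OF subspace_ideal] mpoly.subspace_scale[OF subspace_ideal])
        (auto simp: bad_def is_form_iff_keys)
    then show ?thesis using poly_expand_monom[of p] by simp
  qed
  then show thesis using that by blast
qed

section \<open>Few forms cannot generate a low multiple of an ideal of finite colength\<close>

text \<open>The exponents of the power products of degree \<open>t\<close> of the members of \<open>J\<close>.\<close>

definition exponents :: "'j set \<Rightarrow> nat \<Rightarrow> ('j \<Rightarrow> nat) set" where
  "exponents J t = {\<beta> \<in> Pi\<^sub>E J (\<lambda>_. {..t}). sum \<beta> J = t}"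

lemma finite_exponents: "finite J \<Longrightarrow> finite (exponents J t)"
  unfolding exponents_def by (intro finite_subset[OF _ finite_PiE[of J "\<lambda>_. {..t}"]]) auto

text \<open>The exponent at \<open>j0\<close> is determined by the other ones.\<close>

lemma card_exponents:
  assumes "finite J" "j0 \<in> J"
  shows "card (exponents J t) \<le> (t + 1) ^ (card J - 1)"
proof -
  have "card (exponents J t) \<le> card (Pi\<^sub>E (J - {j0}) (\<lambda>_. {..t}))"
  proof (rule card_inj_on_le)
    show "inj_on (\<lambda>\<beta>. restrict \<beta> (J - {j0})) (exponents J t)"
    proof (rule inj_onI)
      fix \<beta> \<beta>' assume b: "\<beta> \<in> exponents J t" "\<beta>' \<in> exponents J t"
        "restrict \<beta> (J - {j0}) = restrict \<beta>' (J - {j0})"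
      then have eq: "\<beta> j = \<beta>' j" if "j \<in> J - {j0}" for j using that by (metis restrict_apply')
      have "sum \<beta> (J - {j0}) = sum \<beta>' (J - {j0})" using eq by (intro sum.cong) auto
      moreover have "sum \<beta> J = sum \<beta>' J" using b by (simp add: exponents_def)
      ultimately have "\<beta> j0 = \<beta>' j0" using assms by (simp add: sum.remove)
      then show "\<beta> = \<beta>'" using b eq by (intro PiE_ext[of \<beta> J "\<lambda>_. {..t}"]) (auto simp: exponents_def)
    qed
    show "(\<lambda>\<beta>. restrict \<beta> (J - {j0})) ` exponents J t \<subseteq> Pi\<^sub>E (J - {j0}) (\<lambda>_. {..t})"
    proof clarify
      fix \<beta> assume "\<beta> \<in> exponents J t"
      then have "\<beta> j \<le> t" if "j \<in> J" for j using that by (simp add: exponents_def PiE_iff)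
      then show "restrict \<beta> (J - {j0}) \<in> Pi\<^sub>E (J - {j0}) (\<lambda>_. {..t})" by (simp add: PiE_iff)
    qed
  qed (use assms in \<open>simp add: finite_PiE\<close>)
  then show ?thesis using assms by (simp add: card_PiE card_Diff_singleton)
qed

text \<open>Whenever \<open>q\<close> has degree at least \<open>c\<close>, \<open>\<Delta> * q\<close> is a combination of the forms in \<open>J\<close>, whose
  coefficients have degree smaller by \<open>a - D\<close>. Iterating \<open>t\<close> times starting in degree
  \<open>c + t * (a - D)\<close>, one ends with products of \<open>t\<close> members of \<open>J\<close> and coefficients of degree \<open>c\<close>.\<close>

lemma power_mult_in_span_products:
  fixes G J :: "('n::finite, 'k::field) mpoly set"
  assumes G: "finite G" "\<And>g. g \<in> G \<Longrightarrow> is_form a g" and J: "finite J"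
    and c: "\<And>d p. d \<ge> c \<Longrightarrow> is_form d p \<Longrightarrow> p \<in> ideal G"
    and p: "\<And>g j. is_form D (p g j)" "\<And>g. g \<in> G \<Longrightarrow> \<Delta> * g = (\<Sum>j\<in>J. p g j * j)" and "D < a"
  shows "is_form (c + t * (a - D)) q \<Longrightarrow>
    \<Delta> ^ t * q \<in> mpoly.span ((\<lambda>(\<beta>, w). (\<Prod>j\<in>J. j ^ \<beta> j) * monom w) ` (exponents J t \<times> mons UNIV c))"
    (is "_ \<Longrightarrow> _ \<in> mpoly.span (?B t)")
proof (induction t arbitrary: q)
  case 0
  have "(\<lambda>j\<in>J. 0) \<in> exponents J 0" by (auto simp: exponents_def)
  then have "monom w \<in> ?B 0" if "w \<in> mons UNIV c" for w :: "'n monomial"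
    using that by (intro image_eqI[of _ _ "((\<lambda>j\<in>J. 0), w)"]) auto
  then have "mpoly.span (monom ` mons UNIV c) \<subseteq> mpoly.span (?B 0)" by (intro mpoly.span_mono) auto
  then show ?case using 0 by (auto simp: span_monoms is_form_iff_keys)
next
  case (Suc t)
  let ?d = "c + Suc t * (a - D)"
  have qG: "q \<in> ideal G" using c[OF _ Suc.prems] by simp
  have "\<exists>r. (\<forall>g. is_form (?d - a) (r g)) \<and> hcomp ?d q = (if a \<le> ?d then \<Sum>g\<in>G. r g * g else 0)"
    by (rule hcomp_in_ideal[OF G qG, where d = ?d]) blast+
  then obtain r where r: "\<And>g. is_form (?d - a) (r g)" "hcomp ?d q = (if a \<le> ?d then \<Sum>g\<in>G. r g * g else 0)"
    by blast
  have q: "q = (if a \<le> ?d then \<Sum>g\<in>G. r g * g else 0)"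
    using r(2) hcomp_form[OF Suc.prems, of ?d] by simp
  show ?case
  proof (cases "a \<le> ?d")
    case True
    define h where "h j = (\<Sum>g\<in>G. r g * p g j)" for j
    have "?d = c + (a - D) + t * (a - D)" by simp
    then have "?d - a + D = c + t * (a - D)" using True \<open>D < a\<close> by linarith
    then have h: "is_form (c + t * (a - D)) (h j)" for j
      unfolding h_def using is_form_mult[OF r(1) p(1)] by (intro is_form_sum) metis
    have "\<Delta> * q = (\<Sum>g\<in>G. r g * (\<Delta> * g))"
      using q True by (simp add: sum_distrib_left mult.left_commute)
    also have "\<dots> = (\<Sum>g\<in>G. \<Sum>j\<in>J. r g * p g j * j)"
      using p(2) by (intro sum.cong refl) (simp add: sum_distrib_left mult.assoc)
    also have "\<dots> = (\<Sum>j\<in>J. j * h j)"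
      by (subst sum.swap) (simp add: h_def sum_distrib_left mult.commute)
    finally have "\<Delta> ^ Suc t * q = (\<Sum>j\<in>J. j * (\<Delta> ^ t * h j))"
      by (simp add: sum_distrib_left mult.left_commute mult.assoc power_Suc2 del: power_Suc)
    moreover have "j * (\<Delta> ^ t * h j) \<in> mpoly.span (?B (Suc t))" if "j \<in> J" for j
    proof -
      have "mpoly.subspace {x. j * x \<in> mpoly.span (?B (Suc t))}"
        by (rule mpoly.subspaceI)
          (auto simp: distrib_left scale_mult_right intro: mpoly.span_zero mpoly.span_add mpoly.span_scale)
      moreover have "?B t \<subseteq> {x. j * x \<in> mpoly.span (?B (Suc t))}"
      proof clarify
        fix \<beta> and w :: "'n monomial" assume b: "\<beta> \<in> exponents J t" "w \<in> mons UNIV c"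
        let ?\<beta> = "\<beta>(j := Suc (\<beta> j))"
        have "sum ?\<beta> J = Suc (sum \<beta> J)"
          using \<open>j \<in> J\<close> J by (simp add: sum.remove[of J j])
        then have "?\<beta> \<in> exponents J (Suc t)"
          using b(1) \<open>j \<in> J\<close> J member_le_sum[of j J \<beta>]
          by (auto simp: exponents_def PiE_iff extensional_def le_SucI)
        moreover have "(\<Prod>i\<in>J. i ^ ?\<beta> i) = j * (\<Prod>i\<in>J. i ^ \<beta> i)"
          using \<open>j \<in> J\<close> J by (simp add: prod.remove[of J j] mult.assoc)
        ultimately have "j * ((\<Prod>i\<in>J. i ^ \<beta> i) * monom w) \<in> ?B (Suc t)"
          using b(2) by (intro image_eqI[of _ _ "(?\<beta>, w)"]) (auto simp: mult.assoc)
        then show "j * ((\<Prod>i\<in>J. i ^ \<beta> i) * monom w) \<in> mpoly.span (?B (Suc t))" by (rule mpoly.span_base)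
      qed
      ultimately have "mpoly.span (?B t) \<subseteq> {x. j * x \<in> mpoly.span (?B (Suc t))}"
        by (rule mpoly.span_minimal[rotated])
      then show ?thesis using Suc.IH[OF h] by auto
    qed
    ultimately show ?thesis by (simp add: mpoly.span_sum)
  next
    case False
    then show ?thesis using q by (simp add: mpoly.span_zero)
  qed
qed

text \<open>In \<open>power_mult_in_span_products\<close> the forms \<open>q\<close>, and so the products \<open>\<Delta> ^ t * q\<close>, range over a space whose
  dimension grows at least like \<open>t ^ (n - 1)\<close>, but the space that contains these products grows at most
  like \<open>t ^ (card J - 1)\<close>.\<close>

lemma card_ge_of_low_multiple:
  fixes G J :: "('n::{finite,linorder}, 'k::field) mpoly set"
  assumes G: "finite G" "\<And>g. g \<in> G \<Longrightarrow> is_form a g" "G \<noteq> {}" "0 \<notin> G" and J: "finite J"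
    and c: "\<And>d p. d \<ge> c \<Longrightarrow> is_form d p \<Longrightarrow> p \<in> ideal G"
    and p: "\<And>g j. is_form D (p g j)" "\<And>g. g \<in> G \<Longrightarrow> \<Delta> * g = (\<Sum>j\<in>J. p g j * j)"
    and "D < a" "\<Delta> \<noteq> 0"
  shows "CARD('n) \<le> card J"
proof (rule ccontr)
  let ?n = "CARD('n)"
  assume less: "\<not> ?n \<le> card J"
  have "J \<noteq> {}"
  proof
    assume "J = {}"
    obtain g where "g \<in> G" using G(3) by auto
    then show False using p(2)[of g] \<open>J = {}\<close> \<open>\<Delta> \<noteq> 0\<close> G(4) by auto
  qed
  then obtain j0 where j0: "j0 \<in> J" by auto
  then have "card J > 0" using J card_gt_0_iff by blast
  then have n: "?n \<ge> 2" and r: "card J - 1 \<le> ?n - 2" using less by auto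
  let ?K = "card (mons (UNIV :: 'n set) c)"
  have key: "(s + 1) ^ (?n - 1) \<le> (?n * (s + 1)) ^ (?n - 2) * ?K" for s
  proof -
    let ?t = "?n * s"
    let ?m = "c + ?t * (a - D)"
    let ?b = "\<lambda>(\<beta>, w). (\<Prod>j\<in>J. j ^ \<beta> j) * (monom w :: ('n, 'k) mpoly)"
    have "?n * s * 1 \<le> ?n * s * (a - D)" using \<open>D < a\<close> by (intro mult_le_mono2) simp
    then have "?n * s * 1 \<le> ?m" by (rule trans_le_add2)
    then have "?n * s \<le> ?m" by simp
    then have "(s + 1) ^ (?n - 1) \<le> card (mons (UNIV :: 'n set) ?m)" by (rule card_mons_ge)
    also have "\<dots> \<le> card (?b ` (exponents J ?t \<times> mons UNIV c))"
    proof (rule indep_family_card_le[of _ "\<lambda>u. \<Delta> ^ ?t * monom u"])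
      show "indep_family (\<lambda>u. \<Delta> ^ ?t * monom u) (mons UNIV ?m)"
        unfolding indep_family_def
      proof (intro allI impI)
        fix k assume "(\<Sum>u\<in>mons UNIV ?m. scale (k u) (\<Delta> ^ ?t * monom u)) = 0"
        then have "\<Delta> ^ ?t * (\<Sum>u\<in>mons UNIV ?m. scale (k u) (monom u)) = 0"
          by (simp add: sum_distrib_left scale_mult_right)
        then have "(\<Sum>u\<in>mons UNIV ?m. scale (k u) (monom u)) = 0" using \<open>\<Delta> \<noteq> 0\<close> by simp
        then show "\<forall>u\<in>mons UNIV ?m. k u = 0"
          using indep_family_monom[OF finite_mons] by (auto simp: indep_family_def)
      qed
      fix u :: "'n monomial" assume "u \<in> mons UNIV ?m"
      then have form: "is_form ?m (monom u :: ('n, 'k) mpoly)" by (simp add: is_form_def mons_UNIV)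
      show "\<Delta> ^ ?t * monom u \<in> mpoly.span (?b ` (exponents J ?t \<times> mons UNIV c))"
      proof (rule power_mult_in_span_products[where G = G and p = p and D = D and a = a])
        show "p \<in> ideal G" if "c \<le> d" "is_form d p" for d p using c that by blast
      qed (use G J p \<open>D < a\<close> form in simp_all)
    next
      show "finite (?b ` (exponents J ?t \<times> mons UNIV c))"
        by (intro finite_imageI finite_cartesian_product finite_exponents J finite_mons)
    qed simp
    also have "\<dots> \<le> card (exponents J ?t \<times> mons (UNIV :: 'n set) c)"
      by (intro card_image_le finite_cartesian_product finite_exponents J finite_mons)
    also have "\<dots> = card (exponents J ?t) * ?K" by (rule card_cartesian_product)
    also have "\<dots> \<le> (?t + 1) ^ (card J - 1) * ?K" using card_exponents[OF J j0] by (rule mult_right_mono) simp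
    also have "\<dots> \<le> (?n * (s + 1)) ^ (?n - 2) * ?K"
    proof (intro mult_right_mono)
      have "(?t + 1) ^ (card J - 1) \<le> (?t + 1) ^ (?n - 2)" using r by (intro power_increasing) auto
      also have "\<dots> \<le> (?n * (s + 1)) ^ (?n - 2)" using n by (intro power_mono) auto
      finally show "(?t + 1) ^ (card J - 1) \<le> (?n * (s + 1)) ^ (?n - 2)" .
    qed simp
    finally show ?thesis .
  qed
  \<comment> \<open>for this \<open>s\<close> the left side of \<open>key\<close> is too large\<close>
  let ?s = "?n ^ (?n - 2) * ?K"
  have "(?s + 1) * (?s + 1) ^ (?n - 2) = (?s + 1) ^ (?n - 1)"
  proof -
    have "?n - 1 = Suc (?n - 2)" using n by simp
    then show ?thesis by (simp only: power_Suc)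
  qed
  also have "\<dots> \<le> (?n * (?s + 1)) ^ (?n - 2) * ?K" by (rule key)
  also have "\<dots> = ?s * (?s + 1) ^ (?n - 2)" by (simp only: power_mult_distrib ac_simps)
  finally have "?s + 1 \<le> ?s" by simp
  then show False by simp
qed

section \<open>Eliminating generators by linear syzygies\<close>

text \<open>
  Over the field of fractions, \<open>J\<close> is a basis of the free module on \<open>G\<close> modulo some syzygies of \<open>G\<close>, and \<open>p g j / \<Delta>\<close>
  are the coordinates of \<open>g\<close> in this basis. The common denominator \<open>\<Delta>\<close> keeps everything in the polynomial
  ring and its degree under control.
\<close>

definition expresses where
  "expresses G J \<Delta> p D \<longleftrightarrow> J \<subseteq> G \<and> \<Delta> \<noteq> 0 \<and> is_form D \<Delta> \<and> (\<forall>g j. is_form D (p g j)) \<and>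
     (\<forall>g\<in>G. \<Delta> * g = (\<Sum>j\<in>J. p g j * j)) \<and> (\<forall>i\<in>J. \<forall>j\<in>J. p i j = (if i = j then \<Delta> else 0))"

text \<open>Substituting the expressions for \<open>\<Delta> * g\<close> in the syzygy \<open>l\<close> gives a relation
  \<open>(\<Sum>j\<in>J. q j * j) = 0\<close> with \<open>q j0 \<noteq> 0\<close>, by which \<open>j0\<close> can be eliminated at the price of the factor
  \<open>q j0\<close>, a form of degree \<open>D + 1\<close>.\<close>

lemma expresses_step:
  fixes G J :: "('n::{finite,linorder}, 'k::field) mpoly set"
  assumes "finite G" and ex: "expresses G J \<Delta> p D"
    and l: "\<And>g. g \<in> G \<Longrightarrow> is_form 1 (l g)" "(\<Sum>g\<in>G. l g * g) = 0"
    and j0: "j0 \<in> J" "(\<Sum>g\<in>G. l g * p g j0) \<noteq> 0"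
  shows "\<exists>\<Delta>' p'. expresses G (J - {j0}) \<Delta>' p' (Suc (2 * D))"
proof -
  have JG: "J \<subseteq> G" and D: "\<Delta> \<noteq> 0" "is_form D \<Delta>" and pf: "\<And>g j. is_form D (p g j)"
    and pe: "\<And>g. g \<in> G \<Longrightarrow> \<Delta> * g = (\<Sum>j\<in>J. p g j * j)"
    and pd: "\<And>i j. i \<in> J \<Longrightarrow> j \<in> J \<Longrightarrow> p i j = (if i = j then \<Delta> else 0)"
    using ex by (auto simp: expresses_def)
  have finJ: "finite J" using JG assms(1) finite_subset by blast
  define q where "q j = (\<Sum>g\<in>G. l g * p g j)" for j
  have qf: "is_form (1 + D) (q j)" for j
    unfolding q_def by (intro is_form_sum is_form_mult l pf)
  have "(\<Sum>j\<in>J. q j * j) = (\<Sum>g\<in>G. l g * (\<Sum>j\<in>J. p g j * j))"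
    unfolding q_def sum_distrib_right sum_distrib_left mult.assoc by (rule sum.swap)
  also have "\<dots> = (\<Sum>g\<in>G. l g * (\<Delta> * g))" using pe by (intro sum.cong refl) simp
  also have "\<dots> = \<Delta> * (\<Sum>g\<in>G. l g * g)" by (simp add: sum_distrib_left mult.left_commute)
  finally have "(\<Sum>j\<in>J. q j * j) = 0" using l(2) by simp
  then have qj0: "q j0 * j0 = - (\<Sum>j\<in>J - {j0}. q j * j)"
    using finJ j0(1) by (simp add: sum.remove eq_neg_iff_add_eq_0)
  define p' where "p' g j = q j0 * p g j - p g j0 * q j" for g j
  have "is_form (Suc (2 * D)) (p' g j)" for g j
  proof -
    have "is_form ((1 + D) + D) (q j0 * p g j)" "is_form (D + (1 + D)) (p g j0 * q j)"
      by (intro is_form_mult qf pf)+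
    then show ?thesis unfolding p'_def by (intro is_form_diff) (simp_all add: mult_2)
  qed
  moreover have "\<Delta> * q j0 \<noteq> 0" using D j0 by (simp add: q_def)
  moreover have "is_form (Suc (2 * D)) (\<Delta> * q j0)"
    using is_form_mult[OF D(2) qf[of j0]] by (simp add: mult_2)
  moreover have "\<Delta> * q j0 * g = (\<Sum>j\<in>J - {j0}. p' g j * j)" if "g \<in> G" for g
  proof -
    have "\<Delta> * q j0 * g = q j0 * (\<Delta> * g)" by (simp add: ac_simps)
    also have "\<dots> = q j0 * (p g j0 * j0 + (\<Sum>j\<in>J - {j0}. p g j * j))"
      using pe[OF that] finJ j0(1) by (simp add: sum.remove)
    also have "\<dots> = p g j0 * (q j0 * j0) + (\<Sum>j\<in>J - {j0}. q j0 * p g j * j)"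
      by (simp add: distrib_left sum_distrib_left ac_simps)
    also have "\<dots> = (\<Sum>j\<in>J - {j0}. q j0 * p g j * j - p g j0 * q j * j)"
      unfolding qj0 by (simp add: sum_distrib_left sum_subtractf ac_simps)
    also have "\<dots> = (\<Sum>j\<in>J - {j0}. p' g j * j)"
      by (simp add: p'_def left_diff_distrib)
    finally show ?thesis .
  qed
  moreover have "p' i j = (if i = j then \<Delta> * q j0 else 0)" if "i \<in> J - {j0}" "j \<in> J - {j0}" for i j
    using that pd[of i j] pd[of i j0] j0(1) by (auto simp: p'_def mult.commute)
  ultimately have "expresses G (J - {j0}) (\<Delta> * q j0) p' (Suc (2 * D))"
    unfolding expresses_def using JG by auto
  then show ?thesis by blast
qed

text \<open>Keep eliminating as long as the vectors \<open>p g\<close> violate some linear syzygy. Each step changes the degree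
  from \<open>D\<close> to \<open>2 * D + 1\<close> and removes an element of \<open>J\<close>, so the final degree is bounded in terms of the number
  of generators alone.\<close>

lemma elimination:
  fixes G :: "('n::{finite,linorder}, 'k::field) mpoly set"
  assumes "finite G"
  obtains J \<Delta> p D where "expresses G J \<Delta> p D" "D < 2 ^ card G"
    "\<And>l j. (\<And>g. g \<in> G \<Longrightarrow> is_form 1 (l g)) \<Longrightarrow> (\<Sum>g\<in>G. l g * g) = 0 \<Longrightarrow> j \<in> J \<Longrightarrow> (\<Sum>g\<in>G. l g * p g j) = 0"
proof -
  let ?goal = "\<exists>J \<Delta> p D. expresses G J \<Delta> p D \<and> D < 2 ^ card G \<and>
    (\<forall>l j. (\<forall>g\<in>G. is_form 1 (l g)) \<longrightarrow> (\<Sum>g\<in>G. l g * g) = 0 \<longrightarrow> j \<in> J \<longrightarrow> (\<Sum>g\<in>G. l g * p g j) = 0)"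
  have step: "expresses G J \<Delta> p D \<Longrightarrow> Suc D \<le> 2 ^ (card G - card J) \<Longrightarrow> ?goal" for J \<Delta> p D
  proof (induction "card J" arbitrary: J \<Delta> p D rule: less_induct)
    case less
    have JG: "J \<subseteq> G" using less.prems by (simp add: expresses_def)
    have finJ: "finite J" using JG assms finite_subset by blast
    show ?case
    proof (cases "\<forall>l j. (\<forall>g\<in>G. is_form 1 (l g)) \<longrightarrow> (\<Sum>g\<in>G. l g * g) = 0 \<longrightarrow> j \<in> J \<longrightarrow> (\<Sum>g\<in>G. l g * p g j) = 0")
      case True
      have "(2::nat) ^ (card G - card J) \<le> 2 ^ card G" by (intro power_increasing) auto
      then have "D < 2 ^ card G" using less.prems(2) by linarith
      then show ?thesis using True less.prems(1) by blast
    next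
      case False
      then obtain l j0 where l: "\<And>g. g \<in> G \<Longrightarrow> is_form 1 (l g)" "(\<Sum>g\<in>G. l g * g) = 0" "j0 \<in> J"
        "(\<Sum>g\<in>G. l g * p g j0) \<noteq> 0" by blast
      then obtain \<Delta>' p' where e: "expresses G (J - {j0}) \<Delta>' p' (Suc (2 * D))"
        using expresses_step[OF assms less.prems(1)] by blast
      have cJ: "card (J - {j0}) = card J - 1" "card J > 0"
        using l(3) finJ by (auto simp: card_Diff_singleton card_gt_0_iff)
      have "card J \<le> card G" using JG assms by (rule card_mono[rotated])
      then have "card G - card (J - {j0}) = Suc (card G - card J)" using cJ by simp
      then have "Suc (Suc (2 * D)) \<le> 2 ^ (card G - card (J - {j0}))" using less.prems(2) by simp
      then show ?thesis using less.hyps[OF _ e] cJ by simp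
    qed
  qed
  have "expresses G G 1 (\<lambda>i j. if i = j then 1 else 0) 0"
    using assms by (auto simp: expresses_def is_form_one if_distrib[of "\<lambda>x. x * _"] cong: if_cong)
  then have ?goal by (rule step) simp
  then show thesis using that by blast
qed

section \<open>The growth of an equigenerated ideal of finite colength\<close>

lemma card_grow_le:
  fixes S :: "'n::finite monomial set"
  assumes "finite S"
  shows "card (grow UNIV S) \<le> CARD('n) * card S"
proof -
  have "grow UNIV S = (\<Union>u\<in>S. grow UNIV {u})" by (auto simp: grow_def)
  then have "card (grow UNIV S) \<le> (\<Sum>u\<in>S. card (grow UNIV {u}))"
    using card_UN_le[OF assms, of "\<lambda>u. grow UNIV {u}"] by simp
  then show ?thesis by (simp add: card_grow_singleton mult.commute)
qed

text \<open>Multiplying a polynomial by a variable translates its leading monomial, and polynomials with different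
  leading monomials are independent.\<close>

lemma card_grow_leads_le:
  fixes \<phi> :: "'i \<Rightarrow> ('n::{finite,linorder}, 'k::field) mpoly"
  assumes "finite G" "finite A" "A \<subseteq> lead ` (mpoly.span (\<phi> ` G) - {0})"
  shows "card (grow UNIV A) \<le> dim (mpoly.span ((\<lambda>(i, g). var i * \<phi> g) ` (UNIV \<times> G)))"
proof -
  let ?W = "(\<lambda>(i, g). var i * \<phi> g) ` (UNIV \<times> G)"
  have "\<forall>u\<in>A. \<exists>h. h \<in> mpoly.span (\<phi> ` G) \<and> h \<noteq> 0 \<and> lead h = u" using assms(3) by blast
  from bchoice[OF this] obtain h where h: "\<And>u. u \<in> A \<Longrightarrow> h u \<in> mpoly.span (\<phi> ` G)"
    "\<And>u. u \<in> A \<Longrightarrow> h u \<noteq> 0" "\<And>u. u \<in> A \<Longrightarrow> lead (h u) = u" by blast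
  have "\<forall>w\<in>grow UNIV A. \<exists>x. snd x \<in> A \<and> w = ex (fst x) + snd x" by (force simp: grow_iff)
  from bchoice[OF this] obtain x where x: "\<And>w. w \<in> grow UNIV A \<Longrightarrow> snd (x w) \<in> A"
    "\<And>w. w \<in> grow UNIV A \<Longrightarrow> w = ex (fst (x w)) + snd (x w)" by blast
  define f where "f w = monom (ex (fst (x w))) * h (snd (x w))" for w
  have f: "f w \<noteq> 0" "lead (f w) = w" if "w \<in> grow UNIV A" for w
    using h(2,3)[OF x(1)[OF that]] x(2)[OF that] by (simp_all add: f_def lead_monom_mult)
  have "f w \<in> mpoly.span ?W" if "w \<in> grow UNIV A" for w
  proof -
    have "mpoly.subspace {p. monom (ex (fst (x w))) * p \<in> mpoly.span ?W}"
      by (rule mpoly.subspaceI)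
        (auto simp: distrib_left scale_mult_right intro: mpoly.span_zero mpoly.span_add mpoly.span_scale)
    moreover have "\<phi> ` G \<subseteq> {p. monom (ex (fst (x w))) * p \<in> mpoly.span ?W}"
      by (auto simp: var_eq_monom intro!: mpoly.span_base)
    ultimately have "mpoly.span (\<phi> ` G) \<subseteq> {p. monom (ex (fst (x w))) * p \<in> mpoly.span ?W}"
      by (rule mpoly.span_minimal[rotated])
    then show ?thesis using h(1)[OF x(1)[OF that]] by (auto simp: f_def)
  qed
  moreover have "indep_family f (grow UNIV A)"
    using assms(2) f by (intro indep_family_leads) auto
  ultimately show ?thesis using assms(1,2) by (intro indep_family_card_le_dim) auto
qed

text \<open>The first summand exceeds the degree \<open>D\<close> obtained by elimination from \<open>N\<close> generators; the second one
  bounds the degree of the glued set of leading monomials, which is a sum of at most \<open>N\<close> degrees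
  \<open>D + s j\<close> with \<open>s j < N\<close>.\<close>

definition degree_bound :: "nat \<Rightarrow> nat" where
  "degree_bound N = 2 ^ N + N * (2 ^ N + N)"

text \<open>
  With \<open>r = card J\<close>, the leading monomials \<open>A\<close> of the span of the vectors \<open>p g\<close> are glued to a set \<open>C\<close> of at least
  \<open>n + \<delta> + 1 - r\<close> elements, which gives \<open>dim I\<^sub>a\<^sub>+\<^sub>1 \<ge> n * (r - 1) + card (grow UNIV C)\<close>. Here \<open>r \<ge> n\<close>. By
  Macaulay's theorem \<open>C\<close> grows at least as much as the part \<open>L'\<close> of \<open>L\<close> of size \<open>n + \<delta> + 1 - r\<close>, and the
  \<open>r - n\<close> members of \<open>L\<close> outside \<open>L'\<close> are paid for by \<open>n * (r - 1)\<close> exceeding \<open>n * (n - 1)\<close>.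
\<close>

lemma hilbert_function_next_ge:
  fixes G :: "('n::{finite,linorder}, 'k::field) mpoly set" and L :: "'n monomial set"
  assumes G: "finite G" "\<And>g. g \<in> G \<Longrightarrow> is_form a g" "indep_family (\<lambda>g. g) G" "card G = CARD('n) + \<delta>"
    and fs: "regular_sequence fs" "length fs = CARD('n)" "set fs \<subseteq> ideal G"
    and a: "degree_bound (card G) \<le> a"
    and L: "upper_in (mons UNIV a) L" "card L = \<delta> + 1"
  shows "CARD('n) * (CARD('n) - 1) + card (grow UNIV L) \<le> hilbert_function (ideal G) (Suc a)"
proof -
  let ?n = "CARD('n)"
  have n0: "?n > 0" by simp
  have Gne: "G \<noteq> {}" using G(4) n0 by (metis add_is_0 card.empty less_not_refl)
  have G0: "0 \<notin> G"
    using G(1,3) indep_family_iff[OF G(1), of "\<lambda>g. g"] mpoly.dependent_zero by auto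
  obtain J \<Delta> p D where ex: "expresses G J \<Delta> p D" and DN: "D < 2 ^ card G"
    and syz: "\<And>l j. (\<And>g. g \<in> G \<Longrightarrow> is_form 1 (l g)) \<Longrightarrow> (\<Sum>g\<in>G. l g * g) = 0 \<Longrightarrow> j \<in> J \<Longrightarrow> (\<Sum>g\<in>G. l g * p g j) = 0"
    using elimination[OF G(1)] by blast
  have JG: "J \<subseteq> G" and D: "\<Delta> \<noteq> 0" "is_form D \<Delta>" and pf: "\<And>g j. is_form D (p g j)"
    and pe: "\<And>g. g \<in> G \<Longrightarrow> \<Delta> * g = (\<Sum>j\<in>J. p g j * j)"
    and pd: "\<And>i j. i \<in> J \<Longrightarrow> j \<in> J \<Longrightarrow> p i j = (if i = j then \<Delta> else 0)"
    using ex by (auto simp: expresses_def)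
  have finJ: "finite J" using JG G(1) finite_subset by blast
  have Da: "D < a" using DN a by (simp add: degree_bound_def)
  obtain c where c: "\<And>d q. d \<ge> c \<Longrightarrow> is_form d q \<Longrightarrow> q \<in> ideal G"
    using forms_in_ideal_of_regular_sequence[OF G(1,2) fs] by blast
  have rn: "?n \<le> card J"
  proof (rule card_ge_of_low_multiple[where G = G and p = p and D = D and a = a])
    show "q \<in> ideal G" if "c \<le> d" "is_form d q" for d q using c that by blast
  qed (use G Gne G0 finJ pf pe Da D in simp_all)
  then have Jne: "J \<noteq> {}" using n0 by auto
  have rN: "card J \<le> card G" using JG G(1) by (rule card_mono[rotated])
  \<comment> \<open>the vector of the \<open>p g j\<close> is turned into one polynomial by shifting its entries,
    which are forms of degree \<open>D\<close>, into distinct degrees \<open>D + s j\<close>\<close>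
  obtain s where s: "bij_betw s J {0..<card J}" using ex_bij_betw_finite_nat[OF finJ] by blast
  have s_inj: "s i = s j \<longleftrightarrow> i = j" if "i \<in> J" "j \<in> J" for i j
    using s that by (auto simp: bij_betw_def inj_on_def)
  define z :: 'n where "z = (SOME z. True)"
  define x where "x j = (monom (Poly_Mapping.single z (s j)) :: ('n, 'k) mpoly)" for j
  have xf: "is_form (s j) (x j)" for j by (simp add: x_def is_form_def)
  have x0: "x j \<noteq> 0" for j by (simp add: x_def)
  define \<phi> where "\<phi> g = (\<Sum>j\<in>J. p g j * x j)" for g
  have pxf: "is_form (D + s j) (p g j * x j)" for g j by (rule is_form_mult[OF pf xf])
  have hc\<phi>: "hcomp (D + s j) (\<phi> g) = p g j * x j" if "j \<in> J" for g j
  proof -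
    have "hcomp (D + s j) (\<phi> g) = (\<Sum>i\<in>J. if i = j then p g j * x j else 0)"
      unfolding \<phi>_def hcomp_sum using that s_inj
      by (intro sum.cong refl) (simp add: hcomp_form[OF pxf])
    then show ?thesis using that finJ by simp
  qed
  have \<phi>_indep: "indep_family \<phi> G" unfolding indep_family_def
  proof (intro allI impI)
    fix k assume k: "(\<Sum>g\<in>G. scale (k g) (\<phi> g)) = 0"
    have kp: "(\<Sum>g\<in>G. scale (k g) (p g j)) = 0" if "j \<in> J" for j
    proof -
      have "0 = hcomp (D + s j) (\<Sum>g\<in>G. scale (k g) (\<phi> g))"
        using hcomp_form[of 0 0 "D + s j"] k by simp
      also have "\<dots> = (\<Sum>g\<in>G. scale (k g) (p g j)) * x j"
        by (simp add: hcomp_sum hcomp_scale hc\<phi>[OF that] sum_distrib_right scale_mult_left)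
      finally show ?thesis using x0 by simp
    qed
    have "\<Delta> * (\<Sum>g\<in>G. scale (k g) g) = (\<Sum>g\<in>G. scale (k g) (\<Sum>j\<in>J. p g j * j))"
      using pe by (simp add: sum_distrib_left scale_mult_right)
    also have "\<dots> = (\<Sum>g\<in>G. \<Sum>j\<in>J. scale (k g) (p g j) * j)"
      by (simp add: mpoly.scale_sum_right scale_mult_left)
    also have "\<dots> = (\<Sum>j\<in>J. (\<Sum>g\<in>G. scale (k g) (p g j)) * j)"
      by (subst sum.swap) (simp add: sum_distrib_right)
    also have "\<dots> = 0" using kp by simp
    finally have "(\<Sum>g\<in>G. scale (k g) g) = 0" using D by simp
    then show "\<forall>g\<in>G. k g = 0" using G(3) by (auto simp: indep_family_def)
  qed
  let ?W = "(\<lambda>(i, g). var i * \<phi> g) ` (UNIV \<times> G)"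
  have next_degree: "hilbert_function (ideal G) (Suc a) = dim (mpoly.span ((\<lambda>(i, g). var i * g) ` (UNIV \<times> G)))"
    using G(1,2) by (rule hilbert_function_next)
  have dimW: "dim (mpoly.span ?W) \<le> hilbert_function (ideal G) (Suc a)"
    unfolding next_degree
  proof (rule dim_span_le_of_relations)
    fix k :: "'n \<times> ('n, 'k) mpoly \<Rightarrow> 'k"
    assume k: "(\<Sum>y\<in>UNIV \<times> G. scale (k y) (case y of (i, g) \<Rightarrow> var i * g)) = 0"
    define l where "l g = (\<Sum>i\<in>UNIV. scale (k (i, g)) (var i))" for g
    have split: "(\<Sum>y\<in>UNIV \<times> G. scale (k y) (case y of (i, g) \<Rightarrow> var i * \<psi> g)) = (\<Sum>g\<in>G. l g * \<psi> g)"
      for \<psi> :: "('n, 'k) mpoly \<Rightarrow> ('n, 'k) mpoly"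
    proof -
      have "(\<Sum>y\<in>UNIV \<times> G. scale (k y) (case y of (i, g) \<Rightarrow> var i * \<psi> g))
        = (\<Sum>i\<in>UNIV. \<Sum>g\<in>G. scale (k (i, g)) (var i * \<psi> g))"
        by (subst sum.cartesian_product) (simp add: case_prod_unfold)
      also have "\<dots> = (\<Sum>g\<in>G. l g * \<psi> g)"
        by (subst sum.swap) (simp add: l_def sum_distrib_right scale_mult_left)
      finally show ?thesis .
    qed
    have "(\<Sum>g\<in>G. l g * g) = 0" using k split[of "\<lambda>g. g"] by simp
    moreover have "is_form 1 (l g)" for g
      unfolding l_def using is_form_var by (intro is_form_sum is_form_scale) simp
    ultimately have lj: "(\<Sum>g\<in>G. l g * p g j) = 0" if "j \<in> J" for j using syz that by blast
    have "(\<Sum>g\<in>G. l g * \<phi> g) = (\<Sum>j\<in>J. (\<Sum>g\<in>G. l g * p g j) * x j)"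
      unfolding \<phi>_def sum_distrib_left sum_distrib_right mult.assoc by (rule sum.swap)
    also have "\<dots> = 0" using lj by simp
    finally show "(\<Sum>y\<in>UNIV \<times> G. scale (k y) (case y of (i, g) \<Rightarrow> var i * \<phi> g)) = 0"
      using split by simp
  qed (use G(1) in simp)
  define A where "A = lead ` (mpoly.span (\<phi> ` G) - {0})"
  have finA: "finite A" and cardA: "card G \<le> card A"
    unfolding A_def by (rule leads_of_span[OF G(1) \<phi>_indep])+
  have growA: "card (grow UNIV A) \<le> hilbert_function (ideal G) (Suc a)"
    using card_grow_leads_le[OF G(1) finA, of \<phi>] dimW by (simp add: A_def)
  define A' where "A' j = A \<inter> mons UNIV (D + s j)" for j
  have "A \<subseteq> (\<Union>j\<in>J. mons UNIV (D + s j))"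
  proof -
    have "\<phi> ` G \<subseteq> {q. keys q \<subseteq> (\<Union>j\<in>J. mons UNIV (D + s j))}"
    proof clarify
      fix g u assume "u \<in> keys (\<phi> g)"
      then have "u \<in> (\<Union>j\<in>J. keys (p g j * x j))"
        unfolding \<phi>_def using keys_sum_subset[of "\<lambda>j. p g j * x j" J] by blast
      then show "u \<in> (\<Union>j\<in>J. mons UNIV (D + s j))" using pxf[of _ g] unfolding is_form_iff_keys by blast
    qed
    then have "mpoly.span (\<phi> ` G) \<subseteq> {q. keys q \<subseteq> (\<Union>j\<in>J. mons UNIV (D + s j))}"
      by (rule mpoly.span_minimal[OF _ subspace_keys])
    then show ?thesis using lead_in_keys unfolding A_def by blast
  qed
  then have AU: "A = (\<Union>j\<in>J. A' j)" by (auto simp: A'_def)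
  have A'ne: "A' j \<noteq> {}" if "j \<in> J" for j
  proof -
    have "\<phi> j = (\<Sum>i\<in>J. if i = j then \<Delta> * x j else 0)"
      unfolding \<phi>_def using pd[OF that] by (intro sum.cong refl) auto
    then have "\<phi> j = \<Delta> * x j" using that finJ by simp
    then have nz: "\<phi> j \<noteq> 0" and form: "is_form (D + s j) (\<phi> j)"
      using D x0 is_form_mult[OF D(2) xf] by auto
    have "\<phi> j \<in> mpoly.span (\<phi> ` G)" using that JG by (auto intro: mpoly.span_base)
    then have "lead (\<phi> j) \<in> A" using nz by (auto simp: A_def)
    moreover have "lead (\<phi> j) \<in> mons UNIV (D + s j)"
      using lead_in_keys[OF nz] form by (auto simp: is_form_iff_keys)
    ultimately show ?thesis by (auto simp: A'_def)
  qed
  have A'disj: "A' i \<inter> A' j = {}" "grow UNIV (A' i) \<inter> grow UNIV (A' j) = {}"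
    if "i \<in> J" "j \<in> J" "i \<noteq> j" for i j
    using that s_inj by (auto simp: A'_def mons_UNIV grow_iff) (metis mdeg_add mdeg_single add_left_cancel)
  have finA': "finite (A' j)" for j using finA by (simp add: A'_def)
  have sumA: "(\<Sum>j\<in>J. card (A' j)) = card A"
    unfolding AU using finJ finA' A'disj(1) by (intro card_UN_disjoint[symmetric]) auto
  have "grow UNIV A = (\<Union>j\<in>J. grow UNIV (A' j))" unfolding AU by (auto simp: grow_def)
  then have sumgrow: "(\<Sum>j\<in>J. card (grow UNIV (A' j))) = card (grow UNIV A)"
    using finJ finA' A'disj(2) by (simp add: card_UN_disjoint)
  define e where "e = (\<Sum>j\<in>J. D + s j)"
  obtain C :: "'n monomial set" where C: "C \<subseteq> mons UNIV e" "card C + card J = card A + 1"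
    "card (grow UNIV C) + ?n * card J \<le> card (grow UNIV A) + ?n"
    using glue_sets[OF finJ Jne, of A' "\<lambda>j. D + s j"] A'ne sumA sumgrow by (auto simp: A'_def e_def)
  have "e \<le> (\<Sum>j\<in>J. 2 ^ card G + card G)"
    unfolding e_def
  proof (rule sum_mono)
    fix j assume "j \<in> J"
    then have "s j < card J" using bij_betwE[OF s] by simp
    then have "s j \<le> card G" using rN by simp
    then show "D + s j \<le> 2 ^ card G + card G" using DN by (intro add_mono) auto
  qed
  also have "\<dots> \<le> card G * (2 ^ card G + card G)"
    using rN by simp
  also have "\<dots> \<le> a" using a by (simp add: degree_bound_def)
  finally have ea: "e \<le> a" .
  \<comment> \<open>the degree of \<open>C\<close> does not depend on \<open>a\<close>; Macaulay's theorem is applied to a translate in degree \<open>a\<close>\<close>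
  define C' where "C' = (+) (Poly_Mapping.single z (a - e)) ` C"
  have C': "C' \<subseteq> mons UNIV a" "card C' = card C" "card (grow UNIV C') = card (grow UNIV C)"
    using C(1) ea by (auto simp: C'_def mons_UNIV card_image card_grow_translate)
  have k: "?n + \<delta> + 1 - card J \<le> \<delta> + 1" "?n + \<delta> + 1 - card J \<le> card C"
    using rn C(2) cardA G(4) by linarith+
  have Lm: "L \<subseteq> mons UNIV a" using L(1) by (simp add: upper_in_def)
  then have finL: "finite L" using finite_mons finite_subset by blast
  have "card L \<le> card (mons (UNIV :: 'n set) a)" using Lm by (intro card_mono) auto
  then have "?n + \<delta> + 1 - card J \<le> card (mons (UNIV :: 'n set) a)" using k(1) L(2) by linarith
  then obtain L' :: "'n monomial set" where L': "upper_in (mons UNIV a) L'" "card L' = ?n + \<delta> + 1 - card J"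
    by (rule upper_in_exists[OF finite_mons])
  have L'L: "L' \<subseteq> L" using upper_in_card_subset[OF finite_mons L'(1) L(1)] k(1) L' L by simp
  have "card (grow UNIV L') \<le> card (grow UNIV C)"
    using Macaulay_monomials[OF C'(1) L'(1)] C' L'(2) k(2) by simp
  \<comment> \<open>\<open>L\<close> has \<open>card J - n\<close> more elements than \<open>L'\<close>, each of which adds at most \<open>n\<close> to the growth\<close>
  moreover have "card (grow UNIV L) \<le> card (grow UNIV L') + ?n * (card J - ?n)"
  proof -
    have "L = L' \<union> (L - L')" using L'L by auto
    then have "grow UNIV L = grow UNIV L' \<union> grow UNIV (L - L')" by (metis grow_Un)
    then have "card (grow UNIV L) \<le> card (grow UNIV L') + card (grow UNIV (L - L'))"
      by (metis card_Un_le)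
    also have "card (grow UNIV (L - L')) \<le> ?n * card (L - L')" using finL by (intro card_grow_le) auto
    also have "card (L - L') = card J - ?n"
      using L'L finL L L' rn rN G(4) finite_subset[OF L'L finL] by (simp add: card_Diff_subset)
    finally show ?thesis by simp
  qed
  moreover have "?n * (card J - ?n) + ?n * (?n - 1) + ?n = ?n * card J"
  proof -
    have "card J - ?n + (?n - 1) + 1 = card J" using rn n0 by linarith
    then show ?thesis by (metis add_mult_distrib2 mult.right_neutral)
  qed
  ultimately show ?thesis using C(3) growA by linarith
qed

section \<open>Lex plus powers ideals with prescribed growth\<close>

text \<open>Adding the largest missing element raises the cardinality of the union by at most one.\<close>

lemma upper_in_extend:
  assumes "finite M" "upper_in M S" "B \<subseteq> M" "card (S \<union> B) \<le> h" "h \<le> card M"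
  shows "\<exists>T. upper_in M T \<and> S \<subseteq> T \<and> card (T \<union> B) = h"
  using assms(2,4)
proof (induction "card (M - S)" arbitrary: S rule: less_induct)
  case less
  show ?case
  proof (cases "card (S \<union> B) = h")
    case True
    then show ?thesis using less.prems by blast
  next
    case False
    have SM: "S \<subseteq> M" using less.prems by (simp add: upper_in_def)
    have "M - S \<noteq> {}"
    proof
      assume "M - S = {}"
      then have "S \<union> B = M" using SM assms(3) by auto
      then show False using False less.prems assms(5) by simp
    qed
    define x where "x = Max (M - S)"
    have x: "x \<in> M - S" "\<And>y. y \<in> M - S \<Longrightarrow> y \<le> x"
      unfolding x_def using \<open>M - S \<noteq> {}\<close> assms(1) by (auto intro: Max_in[of "M - S", THEN DiffD1]
        Max_in[of "M - S", THEN DiffD2])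
    have "card (M - insert x S) < card (M - S)"
      using x(1) assms(1) by (intro psubset_card_mono) auto
    moreover have "upper_in M (insert x S)"
      using less.prems x unfolding upper_in_def by (auto dest: leD)
    moreover have "card (insert x S \<union> B) \<le> h"
    proof -
      have "card (insert x S \<union> B) \<le> Suc (card (S \<union> B))"
        using card_insert_le_m1 by (simp add: card_insert_if finite_subset[OF SM assms(1)] finite_subset[OF assms(3,1)])
      then show ?thesis using False less.prems(2) by simp
    qed
    ultimately show ?thesis using less.hyps[of "insert x S"] by blast
  qed
qed

definition pure_powers :: "nat \<Rightarrow> 'n monomial set" where
  "pure_powers a = range (\<lambda>i. Poly_Mapping.single i a)"

lemma pure_powers_mons: "pure_powers a \<subseteq> mons (UNIV :: 'n::finite set) a"
  by (auto simp: pure_powers_def mons_UNIV)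

lemma card_pure_powers: "a > 0 \<Longrightarrow> card (pure_powers a :: 'n::finite monomial set) = CARD('n)"
  unfolding pure_powers_def
  by (intro card_image injI) (metis lookup_single_eq lookup_single_not_eq less_not_refl)

text \<open>If \<open>x\<^sub>1\<close> is the first variable, the \<open>a\<close> monomials \<open>x\<^sub>1 ^ k * x\<^sub>i ^ (a - k)\<close> with \<open>k > 0\<close> are larger
  than \<open>x\<^sub>i ^ a\<close> for every other variable \<open>x\<^sub>i\<close>. So a segment with at most \<open>a\<close> elements cannot reach \<open>x\<^sub>i ^ a\<close>.\<close>

lemma segment_pure_powers:
  fixes L :: "'n::{finite,linorder} monomial set"
  assumes L: "upper_in (mons UNIV a) L" "L \<noteq> {}" "card L \<le> a"
  shows "L \<inter> pure_powers a = {Poly_Mapping.single (Min UNIV) a}"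
proof -
  let ?m = "Min (UNIV :: 'n set)"
  have Lm: "L \<subseteq> mons UNIV a" using L by (simp add: upper_in_def)
  have finL: "finite L" using Lm finite_mons finite_subset by blast
  have min: "?m \<le> i" for i by simp
  have top: "Poly_Mapping.single ?m a \<in> L"
  proof -
    obtain u where u: "u \<in> L" using L(2) by auto
    have "\<not> Poly_Mapping.single ?m a < u"
    proof
      assume "Poly_Mapping.single ?m a < u"
      then obtain i where i: "ev (Poly_Mapping.single ?m a) i < ev u i"
        "\<And>j. j < i \<Longrightarrow> ev (Poly_Mapping.single ?m a) j = ev u j" by (auto simp: monomial_less_iff)
      have "ev (Poly_Mapping.single ?m a) ?m \<le> ev u ?m"
      proof (cases "i = ?m")
        case False
        then have "?m < i" using min[of i] by (simp add: less_le)
        then show ?thesis using i(2)[of ?m] by simp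
      qed (use i(1) in simp)
      then have "mdeg (Poly_Mapping.single ?m a) < mdeg u"
        using i(1) by (intro mdeg_strict_mono[of _ _ i]) (auto simp: lookup_single when_def)
      then show False using u Lm by (auto simp: mons_UNIV)
    qed
    then have "u = Poly_Mapping.single ?m a \<or> u < Poly_Mapping.single ?m a" by auto
    then show ?thesis using u L(1) by (auto simp: upper_in_def mons_UNIV)
  qed
  moreover have "i = ?m" if i: "Poly_Mapping.single i a \<in> L" for i
  proof (rule ccontr)
    assume "i \<noteq> ?m"
    define f where "f k = Poly_Mapping.single ?m k + Poly_Mapping.single i (a - k)" for k
    have evf: "ev (f k) ?m = k" for k using \<open>i \<noteq> ?m\<close> by (simp add: f_def lookup_add lookup_single_not_eq)
    have "f k \<in> L" if "k \<le> a" for k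
    proof (cases "k = 0")
      case True
      then show ?thesis using i by (simp add: f_def)
    next
      case False
      have "Poly_Mapping.single i a < f k" unfolding monomial_less_iff
        using False evf[of k] \<open>i \<noteq> ?m\<close> by (intro exI[of _ ?m]) (auto simp: lookup_single_not_eq leD[OF min])
      moreover have "f k \<in> mons UNIV a" using that by (simp add: f_def mons_UNIV)
      ultimately show ?thesis using L(1) i by (auto simp: upper_in_def)
    qed
    then have "f ` {..a} \<subseteq> L" by auto
    moreover have "inj_on f {..a}" using evf by (metis inj_onI)
    ultimately have "card {..a} \<le> card L" using finL by (intro card_inj_on_le[of f])
    then show False using L(3) by simp
  qed
  ultimately show ?thesis unfolding pure_powers_def by blast
qed

lemma multiples_pure_powers:
  shows "d < a \<Longrightarrow> multiples (pure_powers a) \<inter> mons (UNIV :: 'n::finite set) d = {}"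
    and "multiples (pure_powers a) \<inter> mons (UNIV :: 'n set) a = pure_powers a"
    and "multiples (pure_powers a) \<inter> mons (UNIV :: 'n set) (Suc a) = grow UNIV (pure_powers a)"
proof -
  have split: "\<exists>v w. u = v + w \<and> v \<in> pure_powers a \<and> mdeg u = a + mdeg w"
    if "u \<in> multiples (pure_powers a)" for u :: "'n monomial"
  proof -
    obtain v w where "u = v + w" "v \<in> pure_powers a" using \<open>u \<in> _\<close> by (auto simp: multiples_def)
    moreover from \<open>v \<in> _\<close> have "mdeg v = a" by (auto simp: pure_powers_def)
    ultimately show ?thesis by auto
  qed
  then show "multiples (pure_powers a) \<inter> mons (UNIV :: 'n set) d = {}" if "d < a"
    using that by (fastforce simp: mons_UNIV)
  have "u \<in> pure_powers a" if u: "u \<in> multiples (pure_powers a)" "mdeg u = a" for u :: "'n monomial"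
  proof -
    obtain v w where vw: "u = v + w" "v \<in> pure_powers a" "mdeg u = a + mdeg w"
      using split[OF u(1)] by blast
    then have "w \<in> mons UNIV 0" using u(2) by (simp add: mons_UNIV)
    then show ?thesis using vw by (simp add: mons_0)
  qed
  moreover have "u \<in> multiples (pure_powers a)" if "u \<in> pure_powers a" for u :: "'n monomial"
    using that by (auto simp: multiples_def) (metis add.right_neutral)
  ultimately show "multiples (pure_powers a) \<inter> mons (UNIV :: 'n set) a = pure_powers a"
    using pure_powers_mons[of a] by (auto simp: mons_UNIV)
  have "u \<in> grow UNIV (pure_powers a)" if u: "u \<in> multiples (pure_powers a)" "mdeg u = Suc a" for u :: "'n monomial"
  proof -
    obtain v w where vw: "u = v + w" "v \<in> pure_powers a" "mdeg u = a + mdeg w"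
      using split[OF u(1)] by blast
    then have "w \<in> mons UNIV (Suc 0)" using u(2) by (simp add: mons_UNIV)
    then show ?thesis using vw by (auto simp: mons_Suc_0 grow_iff add.commute)
  qed
  moreover have "grow UNIV (pure_powers a) \<subseteq> multiples (pure_powers a) \<inter> mons (UNIV :: 'n set) (Suc a)"
  proof
    fix u :: "'n monomial" assume u: "u \<in> grow UNIV (pure_powers a)"
    then obtain i v where "u = v + ex i" "v \<in> pure_powers a" by (auto simp: grow_iff add.commute)
    then have "u \<in> multiples (pure_powers a)" unfolding multiples_def by blast
    moreover have "u \<in> mons UNIV (Suc a)" using u grow_mons[OF pure_powers_mons] by blast
    ultimately show "u \<in> multiples (pure_powers a) \<inter> mons UNIV (Suc a)" by blast
  qed
  ultimately show "multiples (pure_powers a) \<inter> mons (UNIV :: 'n set) (Suc a) = grow UNIV (pure_powers a)"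
    by (auto simp: mons_UNIV)
qed

text \<open>The lex ideal consists of \<open>L\<close> in degree \<open>a\<close>, of a segment containing \<open>grow UNIV L\<close> in degree \<open>a + 1\<close>
  that is extended until the count is right, and of all monomials in higher degrees, which makes it
  closed under multiplication.\<close>

lemma lpp_ideal_exists:
  fixes L :: "'n::{finite,linorder} monomial set"
  assumes L: "upper_in (mons UNIV a) L" "card L = \<delta> + 1" and a: "\<delta> < a"
    and h: "CARD('n) * (CARD('n) - 1) + card (grow UNIV L) \<le> h" "h \<le> card (mons (UNIV :: 'n set) (Suc a))"
  shows "\<exists>J K :: ('n, 'k::field) mpoly set. lpp_ideal J \<and> lex_ideal K \<and>
    J = K + ideal ((\<lambda>i. var i ^ a) ` UNIV) \<and>
    (\<forall>d<a. hilbert_function J d = 0) \<and> hilbert_function J a = CARD('n) + \<delta> \<and>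
    hilbert_function J (Suc a) = h"
proof -
  let ?P = "pure_powers a :: 'n monomial set"
  have Lm: "L \<subseteq> mons UNIV a" using L by (simp add: upper_in_def)
  have finL: "finite L" using Lm finite_mons finite_subset by blast
  have finP: "finite ?P" by (simp add: pure_powers_def)
  have n0: "CARD('n) > 0" by simp
  have "L \<noteq> {}" using L(2) by auto
  then have LP: "L \<inter> ?P = {Poly_Mapping.single (Min UNIV) a}"
    using segment_pure_powers[OF L(1)] L(2) a by simp
  then have cLP: "card (L \<inter> ?P) = 1" by simp
  then have cLUP: "card (L \<union> ?P) = CARD('n) + \<delta>"
    using card_Un_Int[OF finL finP] card_pure_powers[of a, where 'n = 'n] a L(2) by simp
  have gP: "card (grow UNIV L \<union> grow UNIV ?P) \<le> h"
  proof -
    have "grow UNIV L \<union> grow UNIV ?P = grow UNIV L \<union> grow UNIV (?P - L)" by (auto simp: grow_def)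
    then have "card (grow UNIV L \<union> grow UNIV ?P) \<le> card (grow UNIV L) + card (grow UNIV (?P - L))"
      by (metis card_Un_le)
    also have "card (grow UNIV (?P - L)) \<le> CARD('n) * card (?P - L)" using finP by (intro card_grow_le) auto
    also have "card (?P - L) = CARD('n) - 1"
      using cLP card_pure_powers[of a, where 'n = 'n] a finP
      by (metis card_Diff_subset_Int finite_Int inf_commute less_nat_zero_code not_gr_zero)
    finally show ?thesis using h(1) by simp
  qed
  have "upper_in (mons UNIV (Suc a)) (grow UNIV L)" by (rule upper_in_grow[OF L(1)])
  moreover have "grow UNIV ?P \<subseteq> mons UNIV (Suc a)" by (rule grow_mons[OF pure_powers_mons])
  ultimately obtain T where T: "upper_in (mons UNIV (Suc a)) T" "grow UNIV L \<subseteq> T"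
    "card (T \<union> grow UNIV ?P) = h"
    using upper_in_extend[OF finite_mons _ _ gP h(2)] by blast
  have Tm: "T \<subseteq> mons UNIV (Suc a)" using T by (simp add: upper_in_def)
  define M where "M = L \<union> T \<union> {u. mdeg u \<ge> a + 2}"
  have mult_M: "multiples M = M"
  proof
    show "multiples M \<subseteq> M"
    proof
      fix u assume "u \<in> multiples M"
      then obtain v w where vw: "u = v + w" "v \<in> M" by (auto simp: multiples_def)
      consider "mdeg w = 0" | "mdeg w = Suc 0" "v \<in> L" | "mdeg v + mdeg w \<ge> a + 2"
        using vw(2) Lm Tm by (fastforce simp: M_def mons_UNIV)
      then show "u \<in> M"
      proof cases
        case 1
        then have "w = 0" using mons_0 by (auto simp: mons_UNIV)
        then show ?thesis using vw by simp
      next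
        case 2
        then obtain i where "w = ex i" using mons_Suc_0 by (auto simp: mons_UNIV)
        then have "u \<in> grow UNIV L" using 2 vw(1) by (auto simp: grow_iff add.commute)
        then show ?thesis using T(2) by (auto simp: M_def)
      next
        case 3
        then show ?thesis using vw(1) by (simp add: M_def)
      qed
    qed
    show "M \<subseteq> multiples M" by (auto simp: multiples_def) (metis add.right_neutral)
  qed
  define K where "K = (ideal (monom ` M) :: ('n, 'k) mpoly set)"
  have K: "K = {p. keys p \<subseteq> M}" by (simp add: K_def ideal_monoms mult_M)
  have lexK: "lex_ideal K"
    unfolding lex_ideal_def
  proof (intro conjI allI impI)
    show "monomial_ideal K" by (auto simp: monomial_ideal_def K_def)
    fix u v :: "'n monomial"
    assume uv: "monom v \<in> K" "mdeg u = mdeg v" "lex_less v u"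
    have "v \<in> M" using uv(1) by (simp add: K)
    moreover have "v < u" using uv(3) by (simp add: lex_less_eq_less)
    ultimately have "u \<in> M"
      using uv(2) L(1) T(1) unfolding M_def upper_in_def mons_UNIV by auto
    then show "monom u \<in> K" by (simp add: K)
  qed
  have var_pow: "(var i :: ('n, 'k) mpoly) ^ k = monom (Poly_Mapping.single i k)" for i k
  proof (induction k)
    case (Suc k)
    have "ex i + Poly_Mapping.single i k = Poly_Mapping.single i (Suc k)"
      by (simp flip: single_add)
    then show ?case using Suc by (simp add: var_eq_monom monom_mult)
  qed simp
  define J where "J = K + ideal ((\<lambda>i. var i ^ a) ` (UNIV :: 'n set))"
  have "(\<lambda>i. (var i :: ('n, 'k) mpoly) ^ a) ` UNIV = monom ` ?P"
    by (simp add: pure_powers_def var_pow image_image)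
  then have J: "J = {p. keys p \<subseteq> M \<union> multiples ?P}"
    by (simp add: J_def K ideal_monoms keys_set_plus)
  have HJ: "hilbert_function J d = card ((M \<inter> mons UNIV d) \<union> (multiples ?P \<inter> mons UNIV d))" for d
    unfolding J hilbert_function_keys by (simp add: Int_Un_distrib2)
  have "hilbert_function J d = 0" if "d < a" for d
  proof -
    have "M \<inter> mons UNIV d = {}" using that Lm Tm by (auto simp: M_def mons_UNIV)
    then show ?thesis using multiples_pure_powers(1)[OF that, where 'n = 'n] by (simp add: HJ)
  qed
  moreover have "hilbert_function J a = CARD('n) + \<delta>"
  proof -
    have "M \<inter> mons UNIV a = L" using Lm Tm by (auto simp: M_def mons_UNIV)
    then show ?thesis using cLUP by (simp add: HJ multiples_pure_powers(2))
  qed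
  moreover have "hilbert_function J (Suc a) = h"
  proof -
    have "M \<inter> mons UNIV (Suc a) = T" using Lm Tm by (auto simp: M_def mons_UNIV)
    then show ?thesis using T(3) by (simp add: HJ multiples_pure_powers(3))
  qed
  moreover have "lpp_ideal J"
    unfolding lpp_ideal_def
    by (intro exI[of _ K] exI[of _ UNIV] exI[of _ "\<lambda>_. a"] conjI lexK J_def) (auto intro: mono_onI)
  ultimately show ?thesis using lexK J_def by blast
qed

section \<open>Minimal generators\<close>

lemma minimally_generates_not_redundant:
  assumes "minimally_generates G I" "g \<in> G"
  shows "g \<notin> ideal (G - {g})"
proof
  assume g: "g \<in> ideal (G - {g})"
  have "ideal G = ideal (G - {g})"
    unfolding ring_module.span_eq
  proof
    show "G \<subseteq> ideal (G - {g})"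
    proof
      fix h assume "h \<in> G"
      then show "h \<in> ideal (G - {g})"
        using g by (cases "h = g") (auto intro: ring_module.span_base)
    qed
    show "G - {g} \<subseteq> ideal G" by (auto intro: ring_module.span_base)
  qed
  moreover have "G - {g} \<subset> G" using assms(2) by auto
  ultimately show False using assms(1) unfolding minimally_generates_def by blast
qed

lemma minimal_generator_nonzero: "minimal_generator g I \<Longrightarrow> g \<noteq> 0"
  using minimally_generates_not_redundant ring_module.span_zero
  unfolding minimal_generator_def by metis

lemma minimally_generates_indep:
  fixes G :: "('n::finite, 'k::field) mpoly set"
  assumes "minimally_generates G I" "finite G"
  shows "indep_family (\<lambda>g. g) G"
  unfolding indep_family_def
proof (intro allI impI, rule ccontr)
  fix c assume c: "(\<Sum>g\<in>G. scale (c g) g) = 0" "\<not> (\<forall>g\<in>G. c g = 0)"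
  then obtain g where g: "g \<in> G" "c g \<noteq> 0" by blast
  have "scale (c g) g = - (\<Sum>h\<in>G - {g}. scale (c h) h)"
    using c(1) g(1) assms(2) by (simp add: sum.remove eq_neg_iff_add_eq_0)
  moreover have "(\<Sum>h\<in>G - {g}. scale (c h) h) \<in> ideal (G - {g})"
    unfolding scale_def by (intro ring_module.span_sum ideal_mult_left ring_module.span_base)
  ultimately have "scale (c g) g \<in> ideal (G - {g})" by (simp add: ring_module.span_neg)
  then have "scale (inverse (c g)) (scale (c g) g) \<in> ideal (G - {g})"
    by (simp add: scale_def ideal_mult_left)
  then show False using g minimally_generates_not_redundant[OF assms(1)] by simp
qed

section \<open>Equigenerated defect ideals\<close>

theorem theorem1p4:
  fixes \<delta> :: nat
  assumes "CARD('n::{finite,linorder}) \<ge> 3"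
  shows "\<exists>D::nat. \<forall>I :: ('n, 'k::field_char_0) mpoly set.
    defect_ideal \<delta> I \<longrightarrow> equigenerated I \<longrightarrow> D \<le> alpha I \<longrightarrow>
      (\<exists>J L :: ('n, 'k) mpoly set. lpp_ideal J \<and> lex_ideal L \<and>
             J = L + ideal ((\<lambda>i. var i ^ alpha I) ` UNIV) \<and>
             (\<forall>d \<le> alpha I + 1. hilbert_function J d = hilbert_function I d))"
proof (intro exI[of _ "degree_bound (CARD('n) + \<delta>) + \<delta> + 1"] allI impI)
  fix I :: "('n, 'k) mpoly set"
  assume I: "defect_ideal \<delta> I" "equigenerated I"
    and bound: "degree_bound (CARD('n) + \<delta>) + \<delta> + 1 \<le> alpha I"
  obtain G fs where G: "minimally_generates G I" "finite G" "card G = CARD('n) + \<delta>"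
    and fs: "set fs \<subseteq> I" "length fs = CARD('n)" "regular_sequence fs"
    using I(1) unfolding defect_ideal_def by blast
  have IG: "I = ideal G" using G(1) by (simp add: minimally_generates_def)
  obtain a where a: "\<And>g. minimal_generator g I \<Longrightarrow> is_form a g"
    using I(2) unfolding equigenerated_def by blast
  have Gmin: "minimal_generator g I" if "g \<in> G" for g
    using that G(1) unfolding minimal_generator_def by blast
  have Gform: "is_form a g" if "g \<in> G" for g using a Gmin that by blast
  have "G \<noteq> {}" using G(3) assms by auto
  then obtain g where g: "g \<in> G" by auto
  have alpha: "alpha I = a"
    unfolding alpha_def
  proof (rule Least_equality)
    show "\<exists>g. minimal_generator g I \<and> is_form a g" using g Gmin Gform by blast
    show "a \<le> d" if "\<exists>g. minimal_generator g I \<and> is_form d g" for d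
      using that a is_form_unique minimal_generator_nonzero by blast
  qed
  have Gind: "indep_family (\<lambda>g. g) G" by (rule minimally_generates_indep[OF G(1,2)])
  have a\<delta>: "\<delta> < a" and aD: "degree_bound (card G) \<le> a" using bound alpha G(3) by auto
  have "\<delta> + 1 \<le> card (mons (UNIV :: 'n set) a)"
  proof -
    obtain i j :: 'n where "i \<noteq> j" using assms by (metis One_nat_def UNIV_I card_1_singleton_iff
      is_singletonI' is_singleton_altdef numeral_le_one_iff semiring_norm(70) empty_iff)
    then have "inj_on (\<lambda>k. Poly_Mapping.single i k + Poly_Mapping.single j (a - k)) {..a}"
      by (intro inj_onI) (metis add.right_neutral lookup_add lookup_single_eq lookup_single_not_eq)
    then have "card {..a} \<le> card (mons (UNIV :: 'n set) a)"
      by (rule card_inj_on_le) (auto simp: mons_iff_ev)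
    then show ?thesis using a\<delta> by simp
  qed
  then obtain L where L: "upper_in (mons (UNIV :: 'n set) a) L" "card L = \<delta> + 1"
    using upper_in_exists[OF finite_mons] by metis
  let ?h = "hilbert_function I (Suc a)"
  have "CARD('n) * (CARD('n) - 1) + card (grow UNIV L) \<le> ?h"
    unfolding IG using hilbert_function_next_ge[OF G(2) Gform Gind G(3) fs(3,2) _ aD L] fs(1) IG by simp
  moreover have "?h \<le> card (mons (UNIV :: 'n set) (Suc a))"
  proof -
    have "graded_part I (Suc a) \<subseteq> mpoly.span (monom ` mons UNIV (Suc a))"
      unfolding span_monoms by (auto simp: graded_part_def is_form_iff_keys)
    then have "?h \<le> card ((monom :: _ \<Rightarrow> ('n, 'k) mpoly) ` mons UNIV (Suc a))"
      unfolding hilbert_function_def by (intro mpoly.dim_le_card) auto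
    also have "\<dots> \<le> card (mons (UNIV :: 'n set) (Suc a))" by (rule card_image_le) simp
    finally show ?thesis .
  qed
  ultimately obtain J K :: "('n, 'k) mpoly set" where JK: "lpp_ideal J" "lex_ideal K"
    "J = K + ideal ((\<lambda>i. var i ^ a) ` UNIV)"
    "\<And>d. d < a \<Longrightarrow> hilbert_function J d = 0" "hilbert_function J a = CARD('n) + \<delta>"
    "hilbert_function J (Suc a) = ?h"
    using lpp_ideal_exists[OF L a\<delta>] by blast
  have "hilbert_function J d = hilbert_function I d" if d: "d \<le> a + 1" for d
  proof -
    consider "d < a" | "d = a" | "d = Suc a" using d by linarith
    then show ?thesis
    proof cases
      case 1
      then show ?thesis using JK(4) hilbert_function_low[OF G(2) Gform] IG by simp
    next
      case 2
      then show ?thesis using JK(5) hilbert_function_initial[OF G(2) Gform Gind] IG G(3) by simp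
    qed (use JK(6) in simp)
  qed
  then show "\<exists>J L :: ('n, 'k) mpoly set. lpp_ideal J \<and> lex_ideal L \<and>
      J = L + ideal ((\<lambda>i. var i ^ alpha I) ` UNIV) \<and>
      (\<forall>d \<le> alpha I + 1. hilbert_function J d = hilbert_function I d)"
    unfolding alpha using JK(1-3) by blast
qed

end
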